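(* Let $V$ be a vector configuration of rank $r$ containing no copy of the zero vector, and suppose $\mathrm{DD}(V)\le 2$. Then $V$ admits a codegree$^*$ decomposition of length at least $r-\mathrm{DD}(V)$.
   Context: A vector configuration is a finite family (repetitions allowed) $V$ of vectors in $\mathbb{R}^r$; a subconfiguration is a subfamily, $\operatorname{rank}(V)=\dim\operatorname{lin}(V)$, and cardinalities count multiplicities. For a nonzero linear functional $f$, the oriented linear hyperplane $H=\{f=0\}$ has $\overline{H}^-=\{f\le0\}$. The dual codegree of a (sub)configuration $W$ is $\operatorname{codeg}^*(W)=\min_H|\overline{H}^-\cap W|$ over oriented linear hyperplanes $H$. The covector discrepancy is $\mathrm{DD}(W)=\max_f\big|\,|\{w\in W: f(w)>0\}|-|\{w\in W:f(w)<0\}|\,\big|$ over all linear functionals $f$. A codegree$^*$ decomposition of $V$ of length $m$ is a partition $V=V_0\uplus V_1\uplus\dots\uplus V_m$ into subconfigurations ($V_0$ possibly empty) such that $\operatorname{codeg}^*(V)=\sum_{i=1}^m\operatorname{codeg}^*(V_i)$ and $\operatorname{codeg}^*(V_i)\ge1$ for $1\le i\le m$. *)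

theory Defs
  imports "HOL-Analysis.Analysis"
begin

text \<open>A vector configuration is a finite index set I with a map v : I -> 'a;
  repetitions are allowed since v need not be injective.  A subconfiguration
  is given by a subset W of I.\<close>

definition codeg_star :: "('i \<Rightarrow> 'a::euclidean_space) \<Rightarrow> 'i set \<Rightarrow> nat" where
  "codeg_star v W =
     Min ((\<lambda>f. card {i \<in> W. f (v i) \<le> (0::real)}) ` {f. linear f \<and> f \<noteq> (\<lambda>x. 0)})"

definition covector_discrepancy :: "('i \<Rightarrow> 'a::euclidean_space) \<Rightarrow> 'i set \<Rightarrow> nat" where
  "covector_discrepancy v W =
     Max ((\<lambda>f. nat \<bar>int (card {i \<in> W. f (v i) > (0::real)})
                    - int (card {i \<in> W. f (v i) < 0})\<bar>) ` {f. linear f})"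

definition rank_conf :: "('i \<Rightarrow> 'a::euclidean_space) \<Rightarrow> 'i set \<Rightarrow> nat" where
  "rank_conf v W = dim (span (v ` W))"

definition codeg_star_decomposition ::
  "('i \<Rightarrow> 'a::euclidean_space) \<Rightarrow> 'i set \<Rightarrow> (nat \<Rightarrow> 'i set) \<Rightarrow> nat \<Rightarrow> bool" where
  "codeg_star_decomposition v I Vs m \<longleftrightarrow>
     (\<forall>k\<le>m. Vs k \<subseteq> I) \<and>
     (\<Union>k\<le>m. Vs k) = I \<and>
     (\<forall>k\<le>m. \<forall>l\<le>m. k \<noteq> l \<longrightarrow> Vs k \<inter> Vs l = {}) \<and>
     codeg_star v I = (\<Sum>k=1..m. codeg_star v (Vs k)) \<and>
     (\<forall>k\<in>{1..m}. codeg_star v (Vs k) \<ge> 1)"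

end

theory Submission
  imports Defs
begin

text \<open>
  For a configuration without zero vectors, twice the dual codegree is the number of vectors minus
  the covector discrepancy, so a decomposition is a partition in which discrepancies add up.
  Antipodal pairs have discrepancy \<open>0\<close> and can be split off one by one, each lowering the rank by
  at most one. It remains to treat antipodal-free configurations.

  View the vectors as signed points of a projective space and call a line odd or even according to
  the number of vectors on it. On an odd line the signs alternate, so two neighbouring points
  in an affine chart have opposite signs there. If the discrepancy is at most \<open>1\<close>, all lines are odd, and a
  triangle with no further point on its sides shows that the rank is at most \<open>2\<close>: its three
  vertices would have pairwise opposite signs.

  Let the discrepancy be \<open>2\<close> and the rank at least \<open>4\<close> (otherwise one part suffices). Contracting
  flats and using the case of discrepancy \<open>1\<close>, all planes are even, there is an odd line \<open>L\<close>, the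
  rank is \<open>4\<close>, the even lines through a point lie in a plane, and a plane containing an odd line
  through a point contains exactly one even line through it. Looking at the pencils of lines
  through points of \<open>L\<close>, and comparing signs on neighbouring lines of a pencil, shows that every
  plane through \<open>L\<close> contains exactly one vector outside \<open>L\<close>. These vectors span a plane
  complementary to that of \<open>L\<close>, so \<open>L\<close> and its complement are two parts of discrepancy \<open>1\<close>.
\<close>

section \<open>Discrepancies and perturbation\<close>

definition sg :: "real \<Rightarrow> int" where
  "sg x = (if x > 0 then 1 else if x < 0 then -1 else 0)"

text \<open>Functionals are inner products with a vector \<open>u\<close>, so that one functional is
  perturbed by another simply by adding vectors.\<close>

definition disc :: "('i \<Rightarrow> 'a::euclidean_space) \<Rightarrow> 'i set \<Rightarrow> 'a \<Rightarrow> int" where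
  "disc v W u = (\<Sum>i\<in>W. sg (v i \<bullet> u))"

text \<open>Projectively, the flat of a one-dimensional span is a point with its multiplicity, and
  that of a two-dimensional span is a line.\<close>

definition flat :: "('i \<Rightarrow> 'a::euclidean_space) \<Rightarrow> 'i set \<Rightarrow> 'a set \<Rightarrow> 'i set" where
  "flat v W F = {i \<in> W. v i \<in> F}"

text \<open>The value \<open>t = 0\<close> is included in order to rule out zero vectors.\<close>

definition antipodal_free :: "('i \<Rightarrow> 'a::euclidean_space) \<Rightarrow> 'i set \<Rightarrow> bool" where
  "antipodal_free v W \<longleftrightarrow> (\<forall>i\<in>W. \<forall>j\<in>W. \<forall>t\<ge>0. v j \<noteq> - (t *\<^sub>R v i))"

lemma sg_simps [simp]:
  "sg 0 = 0" "x > 0 \<Longrightarrow> sg x = 1" "x < 0 \<Longrightarrow> sg x = -1"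
  by (auto simp: sg_def)

lemma sg_minus [simp]: "sg (- x) = - sg x"
  by (auto simp: sg_def)

lemma sg_eq_0_iff [simp]: "sg x = 0 \<longleftrightarrow> x = 0"
  by (auto simp: sg_def)

lemma abs_sg: "\<bar>sg x\<bar> = (if x = 0 then 0 else 1)"
  by (auto simp: sg_def)

lemma sg_mult_pos: "c > 0 \<Longrightarrow> sg (c * x) = sg x"
  by (auto simp: sg_def zero_less_mult_iff mult_less_0_iff)

lemma disc_uminus [simp]: "disc v W (- u) = - disc v W u"
  by (simp add: disc_def sum_negf)

lemma disc_zero [simp]: "disc v W 0 = 0"
  by (simp add: disc_def)

lemma disc_empty [simp]: "disc v {} u = 0"
  by (simp add: disc_def)

lemma disc_Un: "finite A \<Longrightarrow> finite B \<Longrightarrow> A \<inter> B = {} \<Longrightarrow> disc v (A \<union> B) u = disc v A u + disc v B u"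
  by (simp add: disc_def sum.union_disjoint)

lemma disc_restrict_nonzero:
  "finite W \<Longrightarrow> K \<subseteq> W \<Longrightarrow> (\<And>i. i \<in> W \<Longrightarrow> i \<notin> K \<Longrightarrow> v i \<bullet> u = 0) \<Longrightarrow> disc v W u = disc v K u"
  unfolding disc_def by (rule sum.mono_neutral_right) auto

lemma disc_parity:
  assumes "finite W" "\<And>i. i \<in> W \<Longrightarrow> v i \<bullet> u \<noteq> 0"
  shows "even (disc v W u) \<longleftrightarrow> even (card W)"
  using assms
proof (induction W rule: finite_induct)
  case (insert i W)
  have "odd (sg (v i \<bullet> u))" using insert.prems[of i] by (auto simp: sg_def)
  then show ?case using insert by (auto simp: disc_def)
qed simp

lemma finite_flat [simp]: "finite W \<Longrightarrow> finite (flat v W F)"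
  by (simp add: flat_def)

lemma flat_subset: "flat v W F \<subseteq> W"
  by (auto simp: flat_def)

lemma flat_mono: "F \<subseteq> G \<Longrightarrow> flat v W F \<subseteq> flat v W G"
  by (auto simp: flat_def)

lemma mem_flat: "i \<in> flat v W F \<longleftrightarrow> i \<in> W \<and> v i \<in> F"
  by (auto simp: flat_def)

lemma flat_flat: "F \<subseteq> G \<Longrightarrow> flat v (flat v W G) F = flat v W F"
  by (auto simp: flat_def)

lemma antipodal_free_subset: "antipodal_free v W \<Longrightarrow> K \<subseteq> W \<Longrightarrow> antipodal_free v K"
  by (auto simp: antipodal_free_def)

lemma antipodal_free_nonzero: "antipodal_free v W \<Longrightarrow> i \<in> W \<Longrightarrow> v i \<noteq> 0"
  unfolding antipodal_free_def by (drule bspec, assumption, drule bspec, assumption, drule spec[of _ 0]) auto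

lemma antipodal_free_pos:
  assumes "antipodal_free v W" "i \<in> W" "j \<in> W" "v j = t *\<^sub>R v i"
  shows "t > 0"
proof (rule ccontr)
  assume "\<not> t > 0"
  then have "- t \<ge> 0" "v j = - ((- t) *\<^sub>R v i)" using assms(4) by auto
  then show False using assms(1-3) unfolding antipodal_free_def by blast
qed

lemma span_perp: "(\<And>x. x \<in> B \<Longrightarrow> x \<bullet> u = 0) \<Longrightarrow> y \<in> span B \<Longrightarrow> y \<bullet> (u::'a::euclidean_space) = 0"
  by (metis inner_commute orthogonal_def orthogonal_to_span)

lemma exists_perp:
  fixes x :: "'a::euclidean_space"
  assumes "x \<notin> span B"
  shows "\<exists>w. (\<forall>y\<in>span B. y \<bullet> w = 0) \<and> x \<bullet> w = 1"
proof -
  obtain y z where yz: "y \<in> span B" "\<And>w. w \<in> span B \<Longrightarrow> orthogonal z w" "x = y + z"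
    using orthogonal_subspace_decomp_exists by metis
  have "z \<noteq> 0" using yz assms by auto
  then have zz: "z \<bullet> z \<noteq> 0" by simp
  have p: "y' \<bullet> z = 0" if "y' \<in> span B" for y'
    using yz(2)[OF that] by (simp add: orthogonal_def inner_commute)
  show ?thesis
  proof (intro exI conjI ballI)
    show "x \<bullet> ((1 / (z \<bullet> z)) *\<^sub>R z) = 1" using zz p[OF yz(1)] yz(3) by (simp add: inner_add_left)
    show "y' \<bullet> ((1 / (z \<bullet> z)) *\<^sub>R z) = 0" if "y' \<in> span B" for y' using p[OF that] by simp
  qed
qed

text \<open>Nonzero values keep their signs under a small change, and zero values become positive
  multiples of \<open>v i \<bullet> g\<close>. As \<open>W\<close> is finite, one \<open>e\<close>
  serves all vectors. This is the composition of covectors.\<close>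

lemma perturb:
  assumes "finite W"
  shows "\<exists>e>0. \<forall>i\<in>W. sg (v i \<bullet> (u + e *\<^sub>R g)) = (if v i \<bullet> u = 0 then sg (v i \<bullet> g) else sg (v i \<bullet> u))"
proof -
  have "eventually (\<lambda>e. \<forall>i\<in>W. sg (v i \<bullet> (u + e *\<^sub>R g)) = (if v i \<bullet> u = 0 then sg (v i \<bullet> g) else sg (v i \<bullet> u))) (at_right (0::real))"
  proof (rule eventually_ball_finite[OF assms], rule ballI)
    fix i assume "i \<in> W"
    have lim: "((\<lambda>e. v i \<bullet> (u + e *\<^sub>R g)) \<longlongrightarrow> v i \<bullet> u) (at_right 0)"
      by (auto intro!: tendsto_eq_intros)
    have pos: "eventually (\<lambda>e. e > 0) (at_right (0::real))"
      by (simp add: eventually_at_right_less)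
    consider "v i \<bullet> u = 0" | "v i \<bullet> u > 0" | "v i \<bullet> u < 0" by linarith
    then show "eventually (\<lambda>e. sg (v i \<bullet> (u + e *\<^sub>R g)) = (if v i \<bullet> u = 0 then sg (v i \<bullet> g) else sg (v i \<bullet> u))) (at_right 0)"
    proof cases
      case 1
      show ?thesis using pos
        by eventually_elim (use 1 in \<open>simp add: inner_add_right sg_mult_pos\<close>)
    next
      case 2
      show ?thesis using order_tendstoD(1)[OF lim 2]
        by eventually_elim (use 2 in simp)
    next
      case 3
      show ?thesis using order_tendstoD(2)[OF lim 3]
        by eventually_elim (use 3 in simp)
    qed
  qed
  moreover have "eventually (\<lambda>e. e > 0) (at_right (0::real))"
    by (simp add: eventually_at_right_less)
  ultimately have "eventually (\<lambda>e. e > 0 \<and> (\<forall>i\<in>W. sg (v i \<bullet> (u + e *\<^sub>R g)) = (if v i \<bullet> u = 0 then sg (v i \<bullet> g) else sg (v i \<bullet> u)))) (at_right (0::real))"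
    by eventually_elim auto
  from eventually_happens'[OF _ this] show ?thesis by simp
qed

lemma disc_perturb:
  assumes "finite W" and
    "\<And>i. i \<in> W \<Longrightarrow> sg (v i \<bullet> u') = (if v i \<bullet> u = 0 then sg (v i \<bullet> g) else sg (v i \<bullet> u))"
  shows "disc v W u' = disc v W u + disc v {i \<in> W. v i \<bullet> u = 0} g"
proof -
  have "disc v W u' = (\<Sum>i\<in>W. sg (v i \<bullet> u) + (if v i \<bullet> u = 0 then sg (v i \<bullet> g) else 0))"
    unfolding disc_def by (rule sum.cong) (auto simp: assms(2))
  then show ?thesis
    by (simp add: disc_def sum.distrib sum.inter_filter assms(1))
qed

text \<open>By induction over \<open>W\<close>: adding a small multiple of a functional that
  vanishes on \<open>span B\<close> but not at the new vector repairs that vector and keeps the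
  earlier nonzero values nonzero.\<close>

lemma exists_generic_perp:
  fixes v :: "'i \<Rightarrow> 'a::euclidean_space"
  assumes "finite W"
  shows "\<exists>u. (\<forall>y\<in>span B. y \<bullet> u = 0) \<and> (\<forall>i\<in>W. v i \<notin> span B \<longrightarrow> v i \<bullet> u \<noteq> 0)"
  using assms
proof (induction W rule: finite_induct)
  case empty
  show ?case by (rule exI[of _ 0]) simp
next
  case (insert k W)
  then obtain u where u: "\<forall>y\<in>span B. y \<bullet> u = 0" "\<forall>i\<in>W. v i \<notin> span B \<longrightarrow> v i \<bullet> u \<noteq> 0" by auto
  show ?case
  proof (cases "v k \<in> span B")
    case True then show ?thesis using u by auto
  next
    case False
    obtain w where w: "\<forall>y\<in>span B. y \<bullet> w = 0" "v k \<bullet> w = 1" using exists_perp[OF False] by auto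
    obtain e where e: "e > 0" "\<forall>i\<in>insert k W. sg (v i \<bullet> (u + e *\<^sub>R w)) = (if v i \<bullet> u = 0 then sg (v i \<bullet> w) else sg (v i \<bullet> u))"
      using perturb[of "insert k W" v u w] insert.hyps by auto
    have "v i \<bullet> (u + e *\<^sub>R w) \<noteq> 0" if "i \<in> insert k W" "v i \<notin> span B" for i
    proof -
      have "sg (v i \<bullet> (u + e *\<^sub>R w)) \<noteq> 0"
        using e(2) that u(2) w(2) by (auto split: if_splits)
      then show ?thesis by auto
    qed
    then show ?thesis using u(1) w(1) by (intro exI[of _ "u + e *\<^sub>R w"]) (auto simp: inner_add_right)
  qed
qed

text \<open>Discrepancies of a contraction and of the contracted flat add up. Perturb
  \<open>u\<close> first so that it vanishes on no vector outside \<open>span B\<close>, then by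
  \<open>g\<close> or \<open>- g\<close>, which decides only the signs inside the flat. The set
  \<open>A\<close> allows the bound itself to come from a contraction.\<close>

lemma contraction_bound:
  assumes fin: "finite W"
    and bound: "\<And>u. (\<forall>x\<in>A. x \<bullet> u = 0) \<Longrightarrow> \<bar>disc v W u\<bar> \<le> d"
    and AB: "A \<subseteq> span B" and u: "\<And>x. x \<in> B \<Longrightarrow> x \<bullet> u = 0" and g: "\<And>x. x \<in> A \<Longrightarrow> x \<bullet> g = 0"
  shows "\<bar>disc v W u\<bar> + \<bar>disc v (flat v W (span B)) g\<bar> \<le> d"
proof -
  have uB: "x \<bullet> u = 0" if "x \<in> span B" for x using span_perp[OF u that] .
  obtain u0 where u0: "\<forall>y\<in>span B. y \<bullet> u0 = 0" "\<forall>i\<in>W. v i \<notin> span B \<longrightarrow> v i \<bullet> u0 \<noteq> 0"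
    using exists_generic_perp[OF fin] by blast
  \<comment> \<open>Both signs of the generic direction are admissible, so the term that it
    contributes can be eliminated in the end.\<close>
  have step: "\<bar>disc v W u + disc v {i \<in> W. v i \<bullet> u = 0} h\<bar> + \<bar>disc v (flat v W (span B)) g\<bar> \<le> d"
    if h: "h = u0 \<or> h = - u0" for h
  proof -
    obtain e where e: "e > 0" "\<forall>i\<in>W. sg (v i \<bullet> (u + e *\<^sub>R h)) = (if v i \<bullet> u = 0 then sg (v i \<bullet> h) else sg (v i \<bullet> u))"
      using perturb[OF fin] by blast
    define u1 where "u1 = u + e *\<^sub>R h"
    have d1: "disc v W u1 = disc v W u + disc v {i \<in> W. v i \<bullet> u = 0} h"
      unfolding u1_def by (rule disc_perturb[OF fin]) (use e in auto)
    have u1B: "x \<bullet> u1 = 0" if "x \<in> span B" for x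
      using uB[OF that] u0(1) that h by (auto simp: u1_def inner_add_right)
    have "v i \<bullet> u1 \<noteq> 0" if "i \<in> W" "v i \<notin> span B" for i
    proof -
      have "sg (v i \<bullet> u1) \<noteq> 0" using e(2) that u0(2) h by (auto simp: u1_def)
      then show ?thesis by auto
    qed
    then have Z: "{i \<in> W. v i \<bullet> u1 = 0} = flat v W (span B)"
      using u1B by (auto simp: flat_def)
    have "\<bar>disc v W u1 + disc v (flat v W (span B)) k\<bar> \<le> d" if k: "k = g \<or> k = - g" for k
    proof -
      obtain e2 where e2: "e2 > 0" "\<forall>i\<in>W. sg (v i \<bullet> (u1 + e2 *\<^sub>R k)) = (if v i \<bullet> u1 = 0 then sg (v i \<bullet> k) else sg (v i \<bullet> u1))"
        using perturb[OF fin] by blast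
      have "disc v W (u1 + e2 *\<^sub>R k) = disc v W u1 + disc v {i \<in> W. v i \<bullet> u1 = 0} k"
        by (rule disc_perturb[OF fin]) (use e2 in auto)
      moreover have "\<bar>disc v W (u1 + e2 *\<^sub>R k)\<bar> \<le> d"
        by (rule bound) (use AB u1B g k in \<open>auto simp: inner_add_right\<close>)
      ultimately show ?thesis using Z by simp
    qed
    from this[of g] this[of "- g"] show ?thesis using d1 by auto
  qed
  from step[of u0] step[of "- u0"] show ?thesis by auto
qed

lemma flat_bound:
  assumes "finite W" "\<And>u. \<bar>disc v W u\<bar> \<le> d"
  shows "\<bar>disc v (flat v W (span B)) u\<bar> \<le> d"
  using contraction_bound[of W "{}" v d B 0 u] assms by auto

text \<open>A generic functional has odd discrepancy by parity, hence never \<open>2\<close> in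
  absolute value. Any \<open>u\<close> can be perturbed in two opposite generic directions, and
  \<open>disc v X u\<close> is the mean of the two results.\<close>

lemma odd_card_bound:
  assumes fin: "finite X" and nz: "\<And>i. i \<in> X \<Longrightarrow> v i \<noteq> 0"
    and bound: "\<And>u. \<bar>disc v X u\<bar> \<le> 2" and odd: "odd (card X)"
  shows "\<bar>disc v X u\<bar> \<le> 1"
proof -
  obtain u0 where u0: "\<forall>i\<in>X. v i \<bullet> u0 \<noteq> 0"
    using exists_generic_perp[OF fin, of "{}" v] nz by auto
  have "\<bar>disc v X u + disc v {i \<in> X. v i \<bullet> u = 0} h\<bar> \<le> 1" if h: "h = u0 \<or> h = - u0" for h
  proof -
    obtain e where e: "e > 0" "\<forall>i\<in>X. sg (v i \<bullet> (u + e *\<^sub>R h)) = (if v i \<bullet> u = 0 then sg (v i \<bullet> h) else sg (v i \<bullet> u))"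
      using perturb[OF fin] by blast
    have d1: "disc v X (u + e *\<^sub>R h) = disc v X u + disc v {i \<in> X. v i \<bullet> u = 0} h"
      by (rule disc_perturb[OF fin]) (use e in auto)
    have "v i \<bullet> (u + e *\<^sub>R h) \<noteq> 0" if "i \<in> X" for i
    proof -
      have "sg (v i \<bullet> (u + e *\<^sub>R h)) \<noteq> 0" using e(2) that u0 h by auto
      then show ?thesis by auto
    qed
    then have "odd (disc v X (u + e *\<^sub>R h))" using disc_parity[OF fin] odd by blast
    then have "\<bar>disc v X (u + e *\<^sub>R h)\<bar> \<noteq> 2" by presburger
    with bound[of "u + e *\<^sub>R h"] show ?thesis unfolding d1 by linarith
  qed
  from this[of u0] this[of "- u0"] show ?thesis by auto
qed

lemma mem_span2: "z \<in> span {a, b} \<longleftrightarrow> (\<exists>\<alpha> \<beta>. z = \<alpha> *\<^sub>R a + \<beta> *\<^sub>R (b::'a::euclidean_space))"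
proof
  assume "z \<in> span {a, b}"
  then obtain k l where "z - k *\<^sub>R a = l *\<^sub>R b" by (auto simp: span_breakdown_eq span_singleton)
  then show "\<exists>\<alpha> \<beta>. z = \<alpha> *\<^sub>R a + \<beta> *\<^sub>R b" by (metis diff_add_cancel add.commute)
next
  assume "\<exists>\<alpha> \<beta>. z = \<alpha> *\<^sub>R a + \<beta> *\<^sub>R b"
  then show "z \<in> span {a, b}"
    by (elim exE) (simp, intro span_add span_scale span_base, simp_all)
qed

lemma mem_span3: "z \<in> span {a, b, c} \<longleftrightarrow> (\<exists>\<alpha> \<beta> \<gamma>. z = \<alpha> *\<^sub>R a + \<beta> *\<^sub>R b + \<gamma> *\<^sub>R (c::'a::euclidean_space))"
proof
  assume "z \<in> span {a, b, c}"
  then obtain k where "z - k *\<^sub>R a \<in> span {b, c}" by (auto simp: span_breakdown_eq[of z a])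
  then obtain l m where "z - k *\<^sub>R a = l *\<^sub>R b + m *\<^sub>R c" by (auto simp: mem_span2)
  then have "z = k *\<^sub>R a + l *\<^sub>R b + m *\<^sub>R c" by (simp add: algebra_simps)
  then show "\<exists>\<alpha> \<beta> \<gamma>. z = \<alpha> *\<^sub>R a + \<beta> *\<^sub>R b + \<gamma> *\<^sub>R c" by blast
next
  assume "\<exists>\<alpha> \<beta> \<gamma>. z = \<alpha> *\<^sub>R a + \<beta> *\<^sub>R b + \<gamma> *\<^sub>R c"
  then show "z \<in> span {a, b, c}"
    by (elim exE) (simp, intro span_add span_scale span_base, simp_all)
qed

lemma disc_ray:
  assumes "finite W" "antipodal_free v W" "x \<in> W"
  shows "disc v (flat v W (span {v x})) (v x) = int (card (flat v W (span {v x})))"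
proof -
  have "sg (v i \<bullet> v x) = 1" if i: "i \<in> flat v W (span {v x})" for i
  proof -
    obtain t where t: "v i = t *\<^sub>R v x" "i \<in> W" using i by (auto simp: mem_flat span_singleton)
    have "t > 0" using antipodal_free_pos[OF assms(2,3) t(2,1)] .
    moreover have "v x \<noteq> 0" using antipodal_free_nonzero[OF assms(2,3)] .
    ultimately show ?thesis by (simp add: t)
  qed
  then show ?thesis by (simp add: disc_def)
qed

text \<open>The functional \<open>u1\<close> is positive and \<open>u2\<close> is negative on both
  \<open>v a\<close> and \<open>v b\<close>. A vector whose two coefficients have opposite signs
  gets the same sign from \<open>u1\<close> and \<open>u2\<close>; as no vector lies between the two
  points, only the two rays change, from \<open>1\<close> to \<open>-1\<close>.\<close>

lemma disc_jump_if_adjacent: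
  assumes fin: "finite W" and af: "antipodal_free v W" and a: "a \<in> W" and b: "b \<in> W"
    and ab: "v b \<notin> span {v a}"
    and nb: "\<And>k \<alpha> \<beta>. k \<in> W \<Longrightarrow> v k = \<alpha> *\<^sub>R v a + \<beta> *\<^sub>R v b \<Longrightarrow> \<not> \<alpha> * \<beta> > 0"
  defines "M \<equiv> flat v W (span {v a, v b})"
  shows "\<exists>u1 u2. (\<forall>i\<in>M. v i \<bullet> u1 \<noteq> 0) \<and>
    disc v M u1 - disc v M u2 \<ge> 2 * (int (card (flat v W (span {v a}))) + int (card (flat v W (span {v b}))))"
proof -
  have nz: "v a \<noteq> 0" "v b \<noteq> 0" using antipodal_free_nonzero[OF af] a b by auto
  have ba: "v a \<notin> span {v b}"
    using ab nz in_span_insert[of "v a" "v b" "{}"] by auto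
  \<comment> \<open>On \<open>span {v a, v b}\<close>, the functionals \<open>p\<close> and
    \<open>q\<close> read off the two coefficients.\<close>
  obtain p where p: "v b \<bullet> p = 0" "v a \<bullet> p = 1" using exists_perp[OF ba] by (meson insertI1 span_base)
  obtain q where q: "v a \<bullet> q = 0" "v b \<bullet> q = 1" using exists_perp[OF ab] by (meson insertI1 span_base)
  have finM: "finite M" using fin by (simp add: M_def)
  obtain e1 where e1: "\<forall>i\<in>M. sg (v i \<bullet> (p + e1 *\<^sub>R q)) = (if v i \<bullet> p = 0 then sg (v i \<bullet> q) else sg (v i \<bullet> p))"
    using perturb[OF finM] by blast
  obtain e2 where e2: "\<forall>i\<in>M. sg (v i \<bullet> (- q + e2 *\<^sub>R (- p))) = (if v i \<bullet> (- q) = 0 then sg (v i \<bullet> (- p)) else sg (v i \<bullet> (- q)))"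
    using perturb[OF finM] by blast
  define u1 where "u1 = p + e1 *\<^sub>R q"
  define u2 where "u2 = - q + e2 *\<^sub>R (- p)"
  define A where "A = flat v W (span {v a})"
  define B where "B = flat v W (span {v b})"
  have key: "v i \<bullet> u1 \<noteq> 0 \<and> sg (v i \<bullet> u1) - sg (v i \<bullet> u2) = (if i \<in> A \<union> B then 2 else 0)"
    if i: "i \<in> M" for i
  proof -
    obtain \<alpha> \<beta> where c: "v i = \<alpha> *\<^sub>R v a + \<beta> *\<^sub>R v b" and iW: "i \<in> W"
      using i by (auto simp: M_def mem_flat mem_span2)
    have vp: "v i \<bullet> p = \<alpha>" "v i \<bullet> q = \<beta>" using p q by (auto simp: c inner_add_left)
    have s1: "sg (v i \<bullet> u1) = (if \<alpha> = 0 then sg \<beta> else sg \<alpha>)" using e1 i vp by (auto simp: u1_def)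
    have s2: "sg (v i \<bullet> u2) = (if \<beta> = 0 then - sg \<alpha> else - sg \<beta>)" using e2 i vp by (auto simp: u2_def)
    have iA: "i \<in> A \<longleftrightarrow> \<beta> = 0"
    proof
      assume "i \<in> A"
      then obtain t where "v i = t *\<^sub>R v a" by (auto simp: A_def mem_flat span_singleton)
      then show "\<beta> = 0" using vp(2) q by simp
    qed (use c iW in \<open>auto simp: A_def mem_flat span_singleton\<close>)
    have iB: "i \<in> B \<longleftrightarrow> \<alpha> = 0"
    proof
      assume "i \<in> B"
      then obtain t where "v i = t *\<^sub>R v b" by (auto simp: B_def mem_flat span_singleton)
      then show "\<alpha> = 0" using vp(1) p by simp
    qed (use c iW in \<open>auto simp: B_def mem_flat span_singleton\<close>)
    have n0: "\<alpha> \<noteq> 0 \<or> \<beta> \<noteq> 0" using antipodal_free_nonzero[OF af iW] c by auto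
    have nn: "\<not> \<alpha> * \<beta> > 0" using nb[OF iW c] .
    have pa: "\<alpha> > 0" if "\<beta> = 0" using antipodal_free_pos[OF af a iW, of \<alpha>] c that by simp
    have pb: "\<beta> > 0" if "\<alpha> = 0" using antipodal_free_pos[OF af b iW, of \<beta>] c that by simp
    have "sg (v i \<bullet> u1) \<noteq> 0" using s1 n0 by auto
    then have "v i \<bullet> u1 \<noteq> 0" by auto
    moreover have "sg (v i \<bullet> u1) - sg (v i \<bullet> u2) = (if i \<in> A \<union> B then 2 else 0)"
    proof (cases "\<alpha> = 0 \<or> \<beta> = 0")
      case True then show ?thesis using s1 s2 iA iB pa pb n0 by auto
    next
      case False
      then have "\<alpha> > 0 \<and> \<beta> < 0 \<or> \<alpha> < 0 \<and> \<beta> > 0"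
        using nn by (metis linorder_neqE_linordered_idom mult_neg_neg mult_pos_pos)
      then show ?thesis using s1 s2 iA iB by auto
    qed
    ultimately show ?thesis by blast
  qed
  have AB: "A \<union> B \<subseteq> M" unfolding A_def B_def M_def
    by (intro Un_least flat_mono span_mono) auto
  have dis: "A \<inter> B = {}"
  proof (rule ccontr)
    assume "A \<inter> B \<noteq> {}"
    then obtain i where "i \<in> A" "i \<in> B" by auto
    then obtain s t where st: "v i = s *\<^sub>R v a" "v i = t *\<^sub>R v b" "i \<in> W"
      unfolding A_def B_def mem_flat span_singleton by blast
    have "v i \<bullet> p = 0" using p st(2) by simp
    moreover have "v i \<bullet> p = s" using p st(1) by simp
    ultimately have "s = 0" by simp
    then show False using st antipodal_free_nonzero[OF af] by auto
  qed
  have "disc v M u1 - disc v M u2 = (\<Sum>i\<in>M. if i \<in> A \<union> B then 2 else 0)"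
    unfolding disc_def sum_subtractf[symmetric] by (rule sum.cong) (use key in auto)
  also have "\<dots> = (\<Sum>i\<in>A \<union> B. 2)"
    by (rule sum.mono_neutral_cong_right[OF finM AB]) auto
  also have "\<dots> = 2 * (int (card A) + int (card B))"
    using dis fin by (simp add: card_Un_disjoint A_def B_def)
  finally show ?thesis using key unfolding A_def B_def by (metis order_refl)
qed

section \<open>Configurations of discrepancy at most one\<close>

lemma scaleR_mem_span_iff: "c \<noteq> 0 \<Longrightarrow> c *\<^sub>R x \<in> span S \<longleftrightarrow> x \<in> span S"
  by (metis span_scale scaleR_scaleR left_inverse scaleR_one)

lemma exists_independent_triple:
  assumes "\<not> dim (v ` X) \<le> 2"
  obtains a b c where "a \<in> X" "b \<in> X" "c \<in> X" "v b \<notin> span {v a}" "v c \<notin> span {v a, v (b::'i)::'a::euclidean_space}" "v a \<noteq> 0"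
proof -
  have "\<exists>a\<in>X. v a \<notin> span {}"
  proof (rule ccontr)
    assume "\<not> ?thesis"
    then have "v ` X \<subseteq> span {}" by auto
    then have "dim (v ` X) \<le> card ({}::'a set)" by (rule dim_le_card) simp
    then show False using assms by (metis card.empty le_trans zero_le)
  qed
  then obtain a where a: "a \<in> X" "v a \<noteq> 0" by auto
  have "\<exists>b\<in>X. v b \<notin> span {v a}"
  proof (rule ccontr)
    assume "\<not> ?thesis"
    then have "dim (v ` X) \<le> card {v a}" by (intro dim_le_card) auto
    then show False using assms by simp
  qed
  then obtain b where b: "b \<in> X" "v b \<notin> span {v a}" by auto
  have "\<exists>c\<in>X. v c \<notin> span {v a, v b}"
  proof (rule ccontr)
    assume "\<not> ?thesis"
    then have "dim (v ` X) \<le> card {v a, v b}" by (intro dim_le_card) auto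
    also have "\<dots> \<le> 2" by (simp add: card_insert_if)
    finally show False using assms by simp
  qed
  then show ?thesis using a b that by blast
qed

lemma independent3:
  fixes a b c :: "'a::euclidean_space"
  assumes "b \<notin> span {a}" "c \<notin> span {a, b}" "a \<noteq> 0" "\<alpha> *\<^sub>R a + \<beta> *\<^sub>R b + \<gamma> *\<^sub>R c = 0"
  shows "\<alpha> = 0 \<and> \<beta> = 0 \<and> \<gamma> = 0"
proof -
  have g: "\<gamma> = 0"
  proof (rule ccontr)
    assume n: "\<gamma> \<noteq> 0"
    have "\<gamma> *\<^sub>R c = (- \<alpha>) *\<^sub>R a + (- \<beta>) *\<^sub>R b"
      using assms(4) by (simp add: add_eq_0_iff)
    then have "\<gamma> *\<^sub>R c \<in> span {a, b}" unfolding mem_span2 by blast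
    then show False using n assms(2) by (simp add: scaleR_mem_span_iff)
  qed
  have h: "\<beta> = 0"
  proof (rule ccontr)
    assume n: "\<beta> \<noteq> 0"
    have "\<beta> *\<^sub>R b = (- \<alpha>) *\<^sub>R a"
      using assms(4) g by (simp add: add_eq_0_iff)
    then have "\<beta> *\<^sub>R b \<in> span {a}" unfolding span_singleton by blast
    then show False using n assms(1) by (simp add: scaleR_mem_span_iff)
  qed
  show ?thesis using g h assms(3,4) by simp
qed

text \<open>Choose a chart in which no vector is at infinity and a triangle containing as few points as
  possible. Two of its vertices have the same sign, and a point between them gives a smaller
  triangle.\<close>

lemma dim_le_2_if_between:
  fixes v :: "'i \<Rightarrow> 'a::euclidean_space"
  assumes fin: "finite X" and nz: "\<And>i. i \<in> X \<Longrightarrow> v i \<noteq> 0"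
    and btw: "\<And>a b. a \<in> X \<Longrightarrow> b \<in> X \<Longrightarrow> v b \<notin> span {v a} \<Longrightarrow>
      \<exists>k\<in>X. \<exists>\<alpha> \<beta>. \<alpha> * \<beta> > 0 \<and> v k = \<alpha> *\<^sub>R v a + \<beta> *\<^sub>R v b"
  shows "dim (v ` X) \<le> 2"
proof (rule ccontr)
  assume big: "\<not> dim (v ` X) \<le> 2"
  obtain g where g: "\<forall>i\<in>X. v i \<bullet> g \<noteq> 0"
    using exists_generic_perp[OF fin, of "{}" v] nz by auto
  \<comment> \<open>Reflected to the positive side of \<open>g\<close>, the vectors become points
    \<open>w i\<close> of an affine chart with signs \<open>s i\<close>.\<close>
  define s where "s i = (if v i \<bullet> g > 0 then 1 else - 1 :: real)" for i
  define w where "w i = s i *\<^sub>R v i" for i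
  have ss: "s i * s i = 1" "s i = 1 \<or> s i = - 1" for i by (auto simp: s_def)
  have vw: "v i = s i *\<^sub>R w i" for i by (simp add: w_def ss)
  have wg: "w i \<bullet> g > 0" if "i \<in> X" for i using g that by (auto simp: w_def s_def)
  define ind where "ind a b c \<longleftrightarrow> (\<forall>\<alpha> \<beta> \<gamma>. \<alpha> *\<^sub>R w a + \<beta> *\<^sub>R w b + \<gamma> *\<^sub>R w c = 0 \<longrightarrow> \<alpha> = 0 \<and> \<beta> = 0 \<and> \<gamma> = 0)" for a b c
  define T where "T a b c = {k \<in> X. \<exists>\<alpha>\<ge>0. \<exists>\<beta>\<ge>0. \<exists>\<gamma>\<ge>0. w k = \<alpha> *\<^sub>R w a + \<beta> *\<^sub>R w b + \<gamma> *\<^sub>R w c}" for a b c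
  have ind_rot: "ind b c a" if "ind a b c" for a b c
    using that unfolding ind_def by (metis add.commute add.left_commute)
  have T_rot_sub: "T a b c \<subseteq> T b c a" for a b c
  proof
    fix k assume "k \<in> T a b c"
    then obtain \<alpha> \<beta> \<gamma> where "k \<in> X" "\<alpha> \<ge> 0" "\<beta> \<ge> 0" "\<gamma> \<ge> 0" "w k = \<alpha> *\<^sub>R w a + \<beta> *\<^sub>R w b + \<gamma> *\<^sub>R w c"
      unfolding T_def by blast
    moreover have "\<alpha> *\<^sub>R w a + \<beta> *\<^sub>R w b + \<gamma> *\<^sub>R w c = \<beta> *\<^sub>R w b + \<gamma> *\<^sub>R w c + \<alpha> *\<^sub>R w a" by simp
    ultimately show "k \<in> T b c a" unfolding T_def by auto
  qed
  have T_rot: "T b c a = T a b c" for a b c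
    using T_rot_sub[of a b c] T_rot_sub[of b c a] T_rot_sub[of c a b] by blast
  have finT: "finite (T a b c)" for a b c using fin by (simp add: T_def)
  \<comment> \<open>A vector between two vertices of equal sign is also between them in the chart.
    Replacing the vertex \<open>b\<close> by it leaves \<open>b\<close> outside the new
    triangle.\<close>
  have smaller: "\<exists>k\<in>X. ind a k c \<and> card (T a k c) < card (T a b c)"
    if abc: "a \<in> X" "b \<in> X" "c \<in> X" "ind a b c" and same: "s a = s b" for a b c
  proof -
    have "v b \<notin> span {v a}"
    proof
      assume "v b \<in> span {v a}"
      then obtain t where "v b = t *\<^sub>R v a" by (auto simp: span_singleton)
      then have "t *\<^sub>R w a + (-1) *\<^sub>R w b + 0 *\<^sub>R w c = 0" using same by (simp add: w_def)
      then show False using abc(4) unfolding ind_def by fastforce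
    qed
    then obtain k \<alpha> \<beta> where k: "k \<in> X" "\<alpha> * \<beta> > 0" "v k = \<alpha> *\<^sub>R v a + \<beta> *\<^sub>R v b"
      using btw abc by blast
    define \<alpha>' where "\<alpha>' = s k * s a * \<alpha>"
    define \<beta>' where "\<beta>' = s k * s a * \<beta>"
    have wk: "w k = \<alpha>' *\<^sub>R w a + \<beta>' *\<^sub>R w b"
    proof -
      have "w k = s k *\<^sub>R (\<alpha> *\<^sub>R (s a *\<^sub>R w a) + \<beta> *\<^sub>R (s b *\<^sub>R w b))"
        by (simp add: vw[symmetric] w_def[of k] k(3))
      then show ?thesis using same by (simp add: \<alpha>'_def \<beta>'_def algebra_simps)
    qed
    have prod: "\<alpha>' * \<beta>' > 0"
    proof -
      have "\<alpha>' * \<beta>' = (s k * s k) * (s a * s a) * (\<alpha> * \<beta>)" by (simp add: \<alpha>'_def \<beta>'_def)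
      then show ?thesis using k(2) by (simp add: ss)
    qed
    \<comment> \<open>Two negative coefficients would put \<open>w k\<close> on the negative side of
      \<open>g\<close>.\<close>
    have pos: "\<alpha>' > 0 \<and> \<beta>' > 0"
    proof (rule ccontr)
      assume "\<not> ?thesis"
      then have neg: "\<alpha>' < 0" "\<beta>' < 0" using prod by (auto simp: zero_less_mult_iff)
      have "w k \<bullet> g = \<alpha>' * (w a \<bullet> g) + \<beta>' * (w b \<bullet> g)" by (simp add: wk inner_add_left)
      also have "\<dots> < 0" using neg wg abc by (simp add: add_neg_neg mult_neg_pos)
      finally show False using wg[OF k(1)] by simp
    qed
    have "ind a k c" unfolding ind_def
    proof (intro allI impI)
      fix x y z assume e: "x *\<^sub>R w a + y *\<^sub>R w k + z *\<^sub>R w c = 0"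
      have "(x + y * \<alpha>') *\<^sub>R w a + (y * \<beta>') *\<^sub>R w b + z *\<^sub>R w c = x *\<^sub>R w a + y *\<^sub>R w k + z *\<^sub>R w c"
        by (simp add: wk algebra_simps)
      then have "x + y * \<alpha>' = 0 \<and> y * \<beta>' = 0 \<and> z = 0" using abc(4) e unfolding ind_def by metis
      then show "x = 0 \<and> y = 0 \<and> z = 0" using pos by auto
    qed
    moreover have "T a k c \<subset> T a b c"
    proof
      show "T a k c \<subseteq> T a b c"
      proof
        fix l assume "l \<in> T a k c"
        then obtain x y z where l: "l \<in> X" "x \<ge> 0" "y \<ge> 0" "z \<ge> 0" "w l = x *\<^sub>R w a + y *\<^sub>R w k + z *\<^sub>R w c"
          unfolding T_def by blast
        have "w l = (x + y * \<alpha>') *\<^sub>R w a + (y * \<beta>') *\<^sub>R w b + z *\<^sub>R w c"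
          by (simp add: l(5) wk algebra_simps)
        moreover have "x + y * \<alpha>' \<ge> 0" "y * \<beta>' \<ge> 0" using l pos by auto
        ultimately show "l \<in> T a b c" unfolding T_def using l by blast
      qed
      have "w b = 0 *\<^sub>R w a + 1 *\<^sub>R w b + 0 *\<^sub>R w c" by simp
      then have "b \<in> T a b c" unfolding T_def using abc(2) by (metis (mono_tags, lifting) mem_Collect_eq order_refl zero_le_one)
      moreover have "b \<notin> T a k c"
      proof
        assume "b \<in> T a k c"
        then obtain x y z where l: "x \<ge> 0" "y \<ge> 0" "z \<ge> 0" "w b = x *\<^sub>R w a + y *\<^sub>R w k + z *\<^sub>R w c"
          unfolding T_def by blast
        have "(x + y * \<alpha>') *\<^sub>R w a + (y * \<beta>' - 1) *\<^sub>R w b + z *\<^sub>R w c = x *\<^sub>R w a + y *\<^sub>R w k + z *\<^sub>R w c - w b"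
          by (simp add: wk algebra_simps)
        also have "\<dots> = 0" using l(4) by simp
        finally have "x + y * \<alpha>' = 0" "y * \<beta>' - 1 = 0" using abc(4) unfolding ind_def by blast+
        moreover have "y * \<alpha>' \<ge> 0" using l pos by simp
        ultimately have "y * \<alpha>' = 0" using l(1) by linarith
        then have "y = 0" using pos by simp
        then show False using \<open>y * \<beta>' - 1 = 0\<close> by simp
      qed
      ultimately show "T a k c \<noteq> T a b c" by blast
    qed
    ultimately show ?thesis using k(1) psubset_card_mono[OF finT] by blast
  qed
  obtain a0 b0 c0 where t0: "a0 \<in> X" "b0 \<in> X" "c0 \<in> X" "v b0 \<notin> span {v a0}" "v c0 \<notin> span {v a0, v b0}" "v a0 \<noteq> 0"
    using exists_independent_triple[OF big] by blast
  have "ind a0 b0 c0" unfolding ind_def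
  proof (intro allI impI)
    fix x y z assume "x *\<^sub>R w a0 + y *\<^sub>R w b0 + z *\<^sub>R w c0 = 0"
    then have "(x * s a0) *\<^sub>R v a0 + (y * s b0) *\<^sub>R v b0 + (z * s c0) *\<^sub>R v c0 = 0"
      by (simp add: w_def)
    from independent3[OF t0(4,5,6) this] show "x = 0 \<and> y = 0 \<and> z = 0" using ss(2) by (metis mult_eq_0_iff zero_neq_one neg_equal_0_iff_equal)
  qed
  then have ex: "\<exists>t. (case t of (a, b, c) \<Rightarrow> a \<in> X \<and> b \<in> X \<and> c \<in> X \<and> ind a b c)"
    using t0 by (intro exI[of _ "(a0, b0, c0)"]) simp
  obtain t where t: "case t of (a, b, c) \<Rightarrow> a \<in> X \<and> b \<in> X \<and> c \<in> X \<and> ind a b c" using ex by blast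
  from ex_has_least_nat[of "\<lambda>t. case t of (a, b, c) \<Rightarrow> a \<in> X \<and> b \<in> X \<and> c \<in> X \<and> ind a b c", OF t, of "\<lambda>(a, b, c). card (T a b c)"]
  obtain a b c where abc: "a \<in> X" "b \<in> X" "c \<in> X" "ind a b c"
    and min: "\<And>x y z. x \<in> X \<Longrightarrow> y \<in> X \<Longrightarrow> z \<in> X \<Longrightarrow> ind x y z \<Longrightarrow> card (T a b c) \<le> card (T x y z)"
    by auto
  \<comment> \<open>Three vertices share two signs.\<close>
  have "s a = s b \<or> s b = s c \<or> s c = s a" using ss(2) by metis
  then show False
  proof (elim disjE)
    assume "s a = s b"
    then show False using smaller[OF abc] min abc by (meson leD)
  next
    assume "s b = s c"
    then show False using smaller[OF abc(2,3,1) ind_rot[OF abc(4)]] min abc T_rot by (metis leD)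
  next
    assume "s c = s a"
    then show False using smaller[OF abc(3,1,2) ind_rot[OF ind_rot[OF abc(4)]]] min abc T_rot by (metis leD)
  qed
qed

text \<open>An adjacent pair would make the discrepancy on its line jump by at least
  \<open>4 * d\<close>, but two values in \<open>[- d, d]\<close> differ by at most
  \<open>2 * d\<close>. So between any two points there is a third.\<close>

lemma dim_le_2_if_saturated:
  assumes fin: "finite W" and af: "antipodal_free v W"
    and bound: "\<And>u. \<bar>disc v W u\<bar> \<le> d" and d: "d \<ge> 1"
    and sat: "\<And>x. x \<in> W \<Longrightarrow> int (card (flat v W (span {v x}))) \<ge> d"
  shows "dim (v ` W) \<le> 2"
proof (rule dim_le_2_if_between[OF fin])
  show "v i \<noteq> 0" if "i \<in> W" for i using antipodal_free_nonzero[OF af that] .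
  fix a b assume ab: "a \<in> W" "b \<in> W" "v b \<notin> span {v a}"
  show "\<exists>k\<in>W. \<exists>\<alpha> \<beta>. \<alpha> * \<beta> > 0 \<and> v k = \<alpha> *\<^sub>R v a + \<beta> *\<^sub>R v b"
  proof (rule ccontr)
    assume "\<not> ?thesis"
    then have nb: "\<not> \<alpha> * \<beta> > 0" if "k \<in> W" "v k = \<alpha> *\<^sub>R v a + \<beta> *\<^sub>R v b" for k \<alpha> \<beta> using that by blast
    obtain u1 u2 where "disc v (flat v W (span {v a, v b})) u1 - disc v (flat v W (span {v a, v b})) u2
        \<ge> 2 * (int (card (flat v W (span {v a}))) + int (card (flat v W (span {v b}))))"
      using disc_jump_if_adjacent[of W v a b] fin af ab nb by blast
    moreover have "\<bar>disc v (flat v W (span {v a, v b})) u\<bar> \<le> d" for u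
      by (rule flat_bound[OF fin bound])
    from this[of u1] this[of u2] have "disc v (flat v W (span {v a, v b})) u1 - disc v (flat v W (span {v a, v b})) u2 \<le> 2 * d"
      by linarith
    ultimately show False using sat[OF ab(1)] sat[OF ab(2)] d unfolding distrib_left by linarith
  qed
qed

lemma self_in_ray: "x \<in> W \<Longrightarrow> x \<in> flat v W (span {v x})"
  by (simp add: mem_flat span_base)

lemma card_ray_pos: "finite W \<Longrightarrow> x \<in> W \<Longrightarrow> card (flat v W (span {v x})) \<ge> 1"
  using self_in_ray[of x W v] card_gt_0_iff[of "flat v W (span {v x})"] finite_flat[of W v "span {v x}"]
  by (metis One_nat_def Suc_leI emptyE)

lemma dim_le_2_if_disc_le_1:
  assumes "finite W" "antipodal_free v W" "\<And>u. \<bar>disc v W u\<bar> \<le> 1"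
  shows "dim (v ` W) \<le> 2"
proof (rule dim_le_2_if_saturated[OF assms])
  show "1 \<le> int (card (flat v W (span {v x})))" if "x \<in> W" for x
    using card_ray_pos[OF assms(1) that, of v] by linarith
qed simp

section \<open>Cancellation of antipodal pairs, and contractions\<close>

lemma not_antipodal_free_pair:
  assumes "\<And>i. i \<in> W \<Longrightarrow> v i \<noteq> 0" "\<not> antipodal_free v W"
  obtains i j t where "i \<in> W" "j \<in> W" "i \<noteq> j" "t > 0" "v j = - (t *\<^sub>R v i)"
proof -
  obtain i j t where ij: "i \<in> W" "j \<in> W" "t \<ge> 0" "v j = - (t *\<^sub>R v i)"
    using assms(2) unfolding antipodal_free_def by blast
  have "t \<noteq> 0" using ij assms(1) by auto
  moreover have "i \<noteq> j"
  proof
    assume "i = j"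
    then have "(1 + t) *\<^sub>R v i = 0" using ij(4) by (simp add: scaleR_left_distrib eq_neg_iff_add_eq_0)
    then show False using ij assms(1) by auto
  qed
  ultimately show ?thesis using that[OF ij(1,2) _ _ ij(4)] ij(3) by simp
qed

lemma disc_pair:
  assumes "i \<noteq> j" "t > 0" "v j = - (t *\<^sub>R v i)"
  shows "disc v {i, j} u = 0"
  using assms by (simp add: disc_def sg_mult_pos)

lemma disc_remove_pair:
  assumes "finite W" "i \<in> W" "j \<in> W" "i \<noteq> j" "t > 0" "v j = - (t *\<^sub>R v i)"
  shows "disc v (W - {i, j}) u = disc v W u"
proof -
  have "disc v ((W - {i, j}) \<union> {i, j}) u = disc v (W - {i, j}) u + disc v {i, j} u"
    by (rule disc_Un) (use assms in auto)
  moreover have "(W - {i, j}) \<union> {i, j} = W" using assms by auto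
  ultimately show ?thesis using disc_pair[of i j t v u] assms by simp
qed

text \<open>Both vectors of a cancelled pair lie on the same projective point and have opposite
  signs, so neither the parities of multiplicities nor the discrepancies change.\<close>

lemma cancel_antipodal_pairs:
  assumes "finite W" "\<And>i. i \<in> W \<Longrightarrow> v i \<noteq> 0"
  shows "\<exists>K\<subseteq>W. antipodal_free v K \<and> (\<forall>u. disc v K u = disc v W u) \<and>
    (\<forall>p. even (card (flat v K (span {p}))) \<longleftrightarrow> even (card (flat v W (span {p}))))"
  using assms
proof (induction W rule: finite_psubset_induct)
  case (psubset W)
  show ?case
  proof (cases "antipodal_free v W")
    case True then show ?thesis by blast
  next
    case False
    obtain i j t where ij: "i \<in> W" "j \<in> W" "i \<noteq> j" "t > 0" "v j = - (t *\<^sub>R v i)"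
      using not_antipodal_free_pair[OF psubset.prems False] by blast
    define W' where "W' = W - {i, j}"
    have "W' \<subset> W" using ij by (auto simp: W'_def)
    then obtain K where K: "K \<subseteq> W'" "antipodal_free v K" "\<And>u. disc v K u = disc v W' u"
      "\<And>p. even (card (flat v K (span {p}))) \<longleftrightarrow> even (card (flat v W' (span {p})))"
      using psubset.IH[of W'] psubset.prems by blast
    have "even (card (flat v W' (span {p}))) \<longleftrightarrow> even (card (flat v W (span {p})))" for p
    proof (cases "v i \<in> span {p}")
      case True
      then have "v j \<in> span {p}" using ij(5) by (simp add: span_neg span_scale)
      then have "flat v W (span {p}) = flat v W' (span {p}) \<union> {i, j}" "flat v W' (span {p}) \<inter> {i, j} = {}"
        using True ij by (auto simp: W'_def mem_flat)
      then have "card (flat v W (span {p})) = card (flat v W' (span {p})) + 2"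
        using ij(3) psubset.hyps by (simp add: card_Un_disjoint W'_def)
      then show ?thesis by simp
    next
      case False
      then have "v j \<notin> span {p}" using ij(4,5) scaleR_mem_span_iff[of "- t" "v i" "{p}"] by simp
      then have "flat v W (span {p}) = flat v W' (span {p})"
        using False by (auto simp: W'_def mem_flat)
      then show ?thesis by simp
    qed
    moreover have "disc v W' u = disc v W u" for u
      unfolding W'_def using disc_remove_pair[OF psubset.hyps ij] .
    ultimately show ?thesis using K \<open>W' \<subset> W\<close> by (intro exI[of _ K]) auto
  qed
qed

text \<open>A projective point of odd multiplicity cannot disappear when pairs are cancelled, so it
  is still present in the antipodal-free remainder, whose rank is at most \<open>2\<close>.\<close>

lemma dim_odd_rays_le_2:
  assumes fin: "finite W" and nz: "\<And>i. i \<in> W \<Longrightarrow> v i \<noteq> 0" and bound: "\<And>u. \<bar>disc v W u\<bar> \<le> 1"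
  shows "dim (v ` {i \<in> W. odd (card (flat v W (span {v i})))}) \<le> 2"
proof -
  obtain K where K: "K \<subseteq> W" "antipodal_free v K" "\<forall>u. disc v K u = disc v W u"
    "\<forall>p. even (card (flat v K (span {p}))) \<longleftrightarrow> even (card (flat v W (span {p})))"
    using cancel_antipodal_pairs[of W v] fin nz by blast
  have "v ` {i \<in> W. odd (card (flat v W (span {v i})))} \<subseteq> span (v ` K)"
  proof clarify
    fix i assume i: "i \<in> W" "odd (card (flat v W (span {v i})))"
    then have "odd (card (flat v K (span {v i})))" using K by blast
    then have "flat v K (span {v i}) \<noteq> {}" by auto
    then obtain k t where k: "k \<in> K" "v k = t *\<^sub>R v i" by (auto simp: mem_flat span_singleton)
    then have "t \<noteq> 0" using nz K(1) by force
    then have "v i \<in> span (v ` K)" using k by (metis imageI span_base scaleR_mem_span_iff)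
    then show "v i \<in> span (v ` K)" .
  qed
  then have "dim (v ` {i \<in> W. odd (card (flat v W (span {v i})))}) \<le> dim (v ` K)"
    by (metis dim_span dim_subset)
  also have "\<dots> \<le> 2"
    by (rule dim_le_2_if_disc_le_1) (use K bound fin in \<open>auto intro: finite_subset\<close>)
  finally show ?thesis .
qed

text \<open>\<open>Q\<close> models the quotient by \<open>span B\<close> within the same type, so
  that a contraction is again a configuration in \<open>'a\<close>. Each new generator
  \<open>b\<close> is killed by projecting orthogonally to \<open>Q b\<close>.\<close>

lemma exists_linear_kernel:
  fixes B :: "'a::euclidean_space set"
  assumes "finite B"
  shows "\<exists>Q::'a \<Rightarrow> 'a. linear Q \<and> (\<forall>x. Q x = 0 \<longleftrightarrow> x \<in> span B)"
  using assms
proof (induction B rule: finite_induct)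
  case empty
  show ?case by (intro exI[of _ id]) (auto simp: linear_iff)
next
  case (insert b B)
  then obtain Q :: "'a \<Rightarrow> 'a" where Q: "linear Q" "\<And>x. Q x = 0 \<longleftrightarrow> x \<in> span B" by auto
  define P where "P x = Q x - ((Q x \<bullet> Q b) / (Q b \<bullet> Q b)) *\<^sub>R Q b" for x
  have "linear P"
  proof (rule linearI)
    show "P (x + y) = P x + P y" for x y
      by (simp add: P_def linear_add[OF Q(1)] inner_add_left add_divide_distrib scaleR_left_distrib)
    show "P (c *\<^sub>R x) = c *\<^sub>R P x" for c x
      by (simp add: P_def linear_scale[OF Q(1)] scaleR_right_diff_distrib)
  qed
  moreover have "P x = 0 \<longleftrightarrow> x \<in> span (insert b B)" for x
  proof -
    have "x \<in> span (insert b B) \<longleftrightarrow> (\<exists>k. Q x = k *\<^sub>R Q b)"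
      unfolding span_breakdown_eq Q(2)[symmetric]
      by (simp add: linear_diff[OF Q(1)] linear_scale[OF Q(1)])
    moreover have "P x = 0" if "Q x = k *\<^sub>R Q b" for k
      using that by (cases "Q b = 0") (simp_all add: P_def)
    moreover have "\<exists>k. Q x = k *\<^sub>R Q b" if "P x = 0" using that by (auto simp: P_def)
    ultimately show ?thesis by blast
  qed
  ultimately show ?case by blast
qed

text \<open>Rank-nullity: lifts of a basis of the span of the image of \<open>S\<close>, together
  with \<open>B\<close>, span everything.\<close>

lemma dim_le_kernel_plus_image:
  fixes Q :: "'a::euclidean_space \<Rightarrow> 'a"
  assumes Q: "linear Q" "\<And>x. Q x = 0 \<longleftrightarrow> x \<in> span B" and fin: "finite B"
  shows "dim (B \<union> S) \<le> card B + dim (Q ` S)"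
proof -
  obtain C where C: "C \<subseteq> Q ` S" "independent C" "Q ` S \<subseteq> span C" "card C = dim (Q ` S)"
    using basis_exists[of "Q ` S"] by blast
  obtain S' where S': "S' \<subseteq> S" "inj_on Q S'" "C = Q ` S'" using C(1) by (meson subset_image_inj)
  have cS': "card S' = dim (Q ` S)" using C(4) S' by (simp add: card_image)
  have finS': "finite S'" using C(2) S'(2,3) by (metis finite_imageD independent_bound)
  have "B \<union> S \<subseteq> span (B \<union> S')"
  proof
    fix x assume "x \<in> B \<union> S"
    then show "x \<in> span (B \<union> S')"
    proof
      assume "x \<in> S"
      then have "Q x \<in> Q ` span S'" using C(3) S'(3) by (metis Q(1) imageI linear_span_image subset_iff)
      then obtain y where y: "y \<in> span S'" "Q (x - y) = 0" by (auto simp: linear_diff[OF Q(1)])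
      have "x - y \<in> span (B \<union> S')" using y(2) Q(2) span_mono[of B "B \<union> S'"] by blast
      moreover have "y \<in> span (B \<union> S')" using y(1) span_mono[of S' "B \<union> S'"] by blast
      ultimately show ?thesis using span_add by fastforce
    qed (simp add: span_base)
  qed
  then have "dim (B \<union> S) \<le> card (B \<union> S')" using fin finS' by (intro dim_le_card) auto
  then show ?thesis using cS' card_Un_le[of B S'] by linarith
qed

text \<open>Contract \<open>span B\<close>. Through the adjoint of \<open>Q\<close>, functionals on
  the quotient are functionals vanishing on \<open>B\<close>, so the contraction has discrepancy at
  most \<open>1\<close>. Its points are the flats one dimension above \<open>span B\<close>, and
  \<open>dim_odd_rays_le_2\<close> bounds the rank of the odd ones.\<close>

lemma dim_odd_flats_le:
  fixes v :: "'i \<Rightarrow> 'a::euclidean_space"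
  assumes fin: "finite W" and B: "finite B"
    and bound: "\<And>u. (\<forall>x\<in>B. x \<bullet> u = 0) \<Longrightarrow> \<bar>disc v W u\<bar> \<le> 1"
    and S: "S \<subseteq> W"
    and odd: "\<And>i. i \<in> S \<Longrightarrow> v i \<notin> span B \<and> odd (card (flat v W (span (insert (v i) B)) - flat v W (span B)))"
  shows "dim (B \<union> v ` S) \<le> card B + 2"
proof -
  obtain Q :: "'a \<Rightarrow> 'a" where Q: "linear Q" "\<And>x. Q x = 0 \<longleftrightarrow> x \<in> span B"
    using exists_linear_kernel[OF B] by blast
  \<comment> \<open>Vectors in \<open>span B\<close> would become zero vectors and are
    dropped.\<close>
  define W1 where "W1 = W - flat v W (span B)"
  define v1 where "v1 = Q \<circ> v"
  have adj: "v1 i \<bullet> u = v i \<bullet> adjoint Q u" for i u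
    by (simp add: v1_def adjoint_works[OF Q(1)])
  have d1: "disc v1 W1 u = disc v W (adjoint Q u)" for u
  proof -
    have "disc v W (adjoint Q u) = disc v W1 (adjoint Q u)"
    proof (rule disc_restrict_nonzero[OF fin])
      show "W1 \<subseteq> W" by (auto simp: W1_def)
      show "v i \<bullet> adjoint Q u = 0" if "i \<in> W" "i \<notin> W1" for i
        using that Q(2)[of "v i"] by (simp add: W1_def mem_flat adjoint_works[OF Q(1)])
    qed
    then show ?thesis by (simp add: disc_def adj)
  qed
  have "dim (v1 ` {i \<in> W1. odd (card (flat v1 W1 (span {v1 i})))}) \<le> 2"
  proof (rule dim_odd_rays_le_2)
    show "finite W1" using fin by (simp add: W1_def)
    show "v1 i \<noteq> 0" if "i \<in> W1" for i using that Q(2) by (auto simp: W1_def mem_flat v1_def)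
    show "\<bar>disc v1 W1 u\<bar> \<le> 1" for u
      unfolding d1
    proof (intro bound ballI)
      fix x assume "x \<in> B"
      then have "Q x = 0" using Q(2) span_base by blast
      then show "x \<bullet> adjoint Q u = 0" by (simp add: adjoint_works[OF Q(1)])
    qed
  qed
  moreover have "S \<subseteq> {i \<in> W1. odd (card (flat v1 W1 (span {v1 i})))}"
  proof
    fix i assume i: "i \<in> S"
    have "flat v1 W1 (span {v1 i}) = flat v W (span (insert (v i) B)) - flat v W (span B)"
    proof -
      have "Q x \<in> span {Q (v i)} \<longleftrightarrow> x \<in> span (insert (v i) B)" for x
        unfolding span_breakdown_eq Q(2)[symmetric] span_empty
        by (simp add: linear_diff[OF Q(1)] linear_scale[OF Q(1)])
      then show ?thesis by (auto simp: mem_flat W1_def v1_def)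
    qed
    then show "i \<in> {i \<in> W1. odd (card (flat v1 W1 (span {v1 i})))}"
      using odd[OF i] i S by (auto simp: W1_def mem_flat)
  qed
  ultimately have "dim (v1 ` S) \<le> 2"
    by (meson dim_subset image_mono order_trans)
  then have "dim (Q ` v ` S) \<le> 2" by (simp add: v1_def image_comp)
  then show ?thesis using dim_le_kernel_plus_image[OF Q B, of "v ` S"] by linarith
qed

section \<open>Even and odd lines in configurations of discrepancy two\<close>

lemma span_pair_exchange:
  fixes a b z :: "'a::euclidean_space"
  assumes "z \<in> span {a, b}" "z \<notin> span {a}"
  shows "span {a, z} = span {a, b}"
proof -
  have "b \<in> span {a, z}" using assms in_span_insert[of z b "{a}"] by (simp add: insert_commute)
  then show ?thesis using assms(1)
    by (simp add: span_eq span_base)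
qed

lemma not_in_span_sym:
  fixes a b :: "'a::euclidean_space"
  assumes "b \<notin> span {a}" "a \<noteq> 0" shows "a \<notin> span {b}"
  using assms in_span_insert[of a b "{}"] by auto

lemma dim_triple:
  fixes a b c :: "'a::euclidean_space"
  assumes "a \<noteq> 0" "b \<notin> span {a}" "c \<notin> span {a, b}"
  shows "dim {a, b, c} = 3"
proof -
  have "c \<notin> span {b, a}" using assms(3) by (metis insert_commute)
  then have "dim {c, b, a} = 3"
    using assms(1,2) dim_insert[of c "{b, a}"] dim_insert[of b "{a}"] dim_insert[of a "{}"] by simp
  moreover have "{a, b, c} = {c, b, a}" by auto
  ultimately show ?thesis by simp
qed

lemma card_flat_split:
  assumes "finite W" "F \<subseteq> G"
  shows "card (flat v W G) = card (flat v W G - flat v W F) + card (flat v W F)"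
  using assms by (simp add: card_Diff_subset card_mono flat_mono)

locale near_balanced =
  fixes v :: "'i \<Rightarrow> 'a::euclidean_space" and W :: "'i set"
  assumes fin: "finite W" and af: "antipodal_free v W" and bound: "\<bar>disc v W u\<bar> \<le> 2"
begin

abbreviation "ray x \<equiv> flat v W (span {v x})"
abbreviation "line x i \<equiv> flat v W (span {v x, v i})"

lemma nz: "i \<in> W \<Longrightarrow> v i \<noteq> 0"
  using antipodal_free_nonzero[OF af] .

lemma line_commute: "line x i = line i x"
  by (simp add: insert_commute)

lemma card_line: "card (line x i) = card (line x i - ray x) + card (ray x)"
  by (rule card_flat_split[OF fin]) (simp add: span_mono)

text \<open>Tested with \<open>v x\<close> itself, the ray of \<open>x\<close> has discrepancy equal
  to its cardinality; the contraction at \<open>x\<close> gets only what remains.\<close>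

lemma perp_bound:
  assumes "x \<in> W" "v x \<bullet> u = 0"
  shows "\<bar>disc v W u\<bar> + int (card (ray x)) \<le> 2"
proof -
  have "\<bar>disc v W u\<bar> + \<bar>disc v (ray x) (v x)\<bar> \<le> 2"
    by (rule contraction_bound[OF fin, of "{}"]) (use bound assms in auto)
  then show ?thesis using disc_ray[OF fin af assms(1)] by simp
qed

lemma card_ray_le_2: "x \<in> W \<Longrightarrow> card (ray x) \<le> 2"
  using perp_bound[of x 0] by simp

text \<open>An odd flat would have discrepancy at most \<open>1\<close>, and antipodal-free
  configurations of that kind have rank at most \<open>2\<close>.\<close>

lemma even_flat:
  assumes "subspace F" "dim (v ` flat v W F) \<ge> 3"
  shows "even (card (flat v W F))"
proof (rule ccontr)
  assume odd: "odd (card (flat v W F))"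
  have sF: "span F = F" using assms(1) by (simp add: span_eq_iff)
  have "\<bar>disc v (flat v W F) u\<bar> \<le> 2" for u
    using flat_bound[OF fin bound, of F u] sF by simp
  then have "\<bar>disc v (flat v W F) u\<bar> \<le> 1" for u
    using odd_card_bound[of "flat v W F" v u] fin nz odd by (auto simp: mem_flat)
  then have "dim (v ` flat v W F) \<le> 2"
    using dim_le_2_if_disc_le_1[of "flat v W F" v] fin antipodal_free_subset[OF af flat_subset] by auto
  then show False using assms(2) by simp
qed

text \<open>A double point uses up the whole bound, so a functional vanishing at \<open>x\<close> is
  balanced on the line. Taken generic, its value has the parity of the number of vectors of the line
  off \<open>x\<close>.\<close>

lemma even_line_if_double:
  assumes "x \<in> W" "card (ray x) = 2"
  shows "even (card (line x i))"
proof -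
  have b0: "\<bar>disc v W u\<bar> \<le> 0" if "\<forall>y\<in>{v x}. y \<bullet> u = 0" for u
    using perp_bound[OF assms(1), of u] that assms(2) by simp
  obtain g where g: "\<forall>y\<in>span {v x}. y \<bullet> g = 0" "\<forall>i\<in>W. v i \<notin> span {v x} \<longrightarrow> v i \<bullet> g \<noteq> 0"
    using exists_generic_perp[OF fin, of "{v x}" v] by blast
  have "\<bar>disc v W 0\<bar> + \<bar>disc v (line x i) g\<bar> \<le> 0"
    by (rule contraction_bound[OF fin b0]) (use g in \<open>auto simp: span_base\<close>)
  then have "disc v (line x i) g = 0" by simp
  moreover have "disc v (line x i) g = disc v (line x i - ray x) g"
    by (rule disc_restrict_nonzero) (use fin g in \<open>auto simp: mem_flat\<close>)
  moreover have "even (disc v (line x i - ray x) g) \<longleftrightarrow> even (card (line x i - ray x))"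
    by (rule disc_parity) (use fin g in \<open>auto simp: mem_flat\<close>)
  ultimately show ?thesis using card_line[of x i] assms(2) by simp
qed

lemma card_ray_1_if_odd_line:
  assumes "x \<in> W" "odd (card (line x i))"
  shows "card (ray x) = 1"
  using card_ray_le_2[OF assms(1)] even_line_if_double[OF assms(1)] assms(2)
    card_ray_pos[OF fin assms(1), of v] by (metis One_nat_def Suc_1 le_SucE le_antisym)

text \<open>At a simple point the contraction has discrepancy at most \<open>1\<close>. Removing
  \<open>x\<close> turns even lines into odd points of the contraction, and these have rank at most
  \<open>2\<close>.\<close>

lemma dim_even_lines_le_3:
  assumes "x \<in> W" "card (ray x) = 1" "S \<subseteq> W"
    and S: "\<And>i. i \<in> S \<Longrightarrow> v i \<notin> span {v x} \<and> even (card (line x i))"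
  shows "dim (insert (v x) (v ` S)) \<le> 3"
proof -
  have "dim ({v x} \<union> v ` S) \<le> card {v x} + 2"
  proof (rule dim_odd_flats_le[OF fin _ _ assms(3)])
    show "\<bar>disc v W u\<bar> \<le> 1" if "\<forall>y\<in>{v x}. y \<bullet> u = 0" for u
      using perp_bound[OF assms(1), of u] that assms(2) by simp
    show "v i \<notin> span {v x} \<and> odd (card (flat v W (span {v i, v x}) - ray x))" if "i \<in> S" for i
      using S[OF that] card_line[of x i] assms(2) by (simp add: insert_commute)
  qed simp
  then show ?thesis by simp
qed

text \<open>If all lines were even, a simple point would force rank at most \<open>3\<close>; and if
  there were no simple point, \<open>dim_le_2_if_saturated\<close> would apply with
  \<open>d = 2\<close>.\<close>

lemma exists_odd_line:
  assumes big: "dim (v ` W) \<ge> 4"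
  shows "\<exists>a\<in>W. \<exists>b\<in>W. v b \<notin> span {v a} \<and> odd (card (line a b))"
proof (rule ccontr)
  assume "\<not> ?thesis"
  then have ev: "even (card (line a b))" if "a \<in> W" "b \<in> W" "v b \<notin> span {v a}" for a b
    using that by blast
  show False
  proof (cases "\<exists>x\<in>W. card (ray x) = 1")
    case True
    then obtain x where x: "x \<in> W" "card (ray x) = 1" by blast
    define S where "S = {i \<in> W. v i \<notin> span {v x}}"
    have "dim (insert (v x) (v ` S)) \<le> 3"
      by (rule dim_even_lines_le_3[OF x]) (use ev x in \<open>auto simp: S_def\<close>)
    moreover have "v ` W \<subseteq> span (insert (v x) (v ` S))"
    proof clarify
      fix i assume "i \<in> W"
      then show "v i \<in> span (insert (v x) (v ` S))"
        using span_mono[of "{v x}" "insert (v x) (v ` S)"]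
        by (cases "v i \<in> span {v x}") (auto simp: S_def intro: span_base)
    qed
    then have "dim (v ` W) \<le> dim (insert (v x) (v ` S))" by (metis dim_span dim_subset)
    ultimately show False using big by simp
  next
    case False
    have "dim (v ` W) \<le> 2"
    proof (rule dim_le_2_if_saturated[OF fin af bound])
      fix x assume x: "x \<in> W"
      then have "card (ray x) \<noteq> 1" using False by blast
      then show "2 \<le> int (card (ray x))" using card_ray_pos[OF fin x, of v] by linarith
    qed simp
    then show False using big by simp
  qed
qed

text \<open>By parity, an odd line has discrepancy at least \<open>1\<close>, which leaves at most
  \<open>1\<close> for its contraction.\<close>

lemma odd_line_contraction:
  assumes "odd (card (line a b))" "v a \<bullet> u = 0" "v b \<bullet> u = 0"
  shows "\<bar>disc v W u\<bar> \<le> 1"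
proof -
  obtain g where g: "\<forall>i\<in>W. v i \<bullet> g \<noteq> 0"
    using exists_generic_perp[OF fin, of "{}" v] nz by auto
  have "\<bar>disc v W u\<bar> + \<bar>disc v (line a b) g\<bar> \<le> 2"
    by (rule contraction_bound[OF fin, of "{}"]) (use bound assms in auto)
  moreover have "even (disc v (line a b) g) \<longleftrightarrow> even (card (line a b))"
    by (rule disc_parity) (use fin g in \<open>auto simp: mem_flat\<close>)
  then have "disc v (line a b) g \<noteq> 0" using assms(1) by auto
  ultimately show ?thesis by linarith
qed

text \<open>The contraction of the odd line has discrepancy at most \<open>1\<close>. Planes are
  even, so every plane through the line has an odd number of vectors off it. Thus all points of the
  contraction are odd, and its rank is at most \<open>2\<close>.\<close>

lemma dim_le_4_if_odd_line:
  assumes a: "a \<in> W" and b: "b \<in> W" and ab: "v b \<notin> span {v a}" and odd: "odd (card (line a b))"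
  shows "dim (v ` W) \<le> 4"
proof -
  define S where "S = W - line a b"
  have "dim ({v a, v b} \<union> v ` S) \<le> card {v a, v b} + 2"
  proof (rule dim_odd_flats_le[OF fin])
    show "\<bar>disc v W u\<bar> \<le> 1" if "\<forall>y\<in>{v a, v b}. y \<bullet> u = 0" for u
      using odd_line_contraction[OF odd] that by simp
    show "S \<subseteq> W" by (auto simp: S_def)
    fix i assume i: "i \<in> S"
    then have iW: "i \<in> W" "v i \<notin> span {v a, v b}" by (auto simp: S_def mem_flat)
    let ?F = "span {v i, v a, v b}"
    have "{v a, v b, v i} \<subseteq> v ` flat v W ?F" using a b iW by (auto simp: mem_flat span_base)
    then have "3 \<le> dim (v ` flat v W ?F)"
      using dim_subset[of "{v a, v b, v i}"] dim_triple[OF nz[OF a] ab iW(2)] by metis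
    then have "even (card (flat v W ?F))" by (intro even_flat) auto
    moreover have "card (flat v W ?F) = card (flat v W ?F - line a b) + card (line a b)"
      by (rule card_flat_split[OF fin]) (auto intro: span_mono[THEN subsetD])
    ultimately show "v i \<notin> span {v a, v b} \<and> odd (card (flat v W (span (insert (v i) {v a, v b})) - line a b))"
      using odd iW by auto
  qed simp
  also have "card {v a, v b} \<le> 2" by (simp add: card_insert_if)
  finally have "dim ({v a, v b} \<union> v ` S) \<le> 4" by simp
  moreover have "v ` W \<subseteq> span ({v a, v b} \<union> v ` S)"
  proof clarify
    fix i assume "i \<in> W"
    then show "v i \<in> span ({v a, v b} \<union> v ` S)"
      using span_mono[of "{v a, v b}" "{v a, v b} \<union> v ` S"]
      by (cases "v i \<in> span {v a, v b}") (auto simp: S_def mem_flat intro: span_base)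
  qed
  then have "dim (v ` W) \<le> dim ({v a, v b} \<union> v ` S)" by (metis dim_span dim_subset)
  ultimately show ?thesis by simp
qed

lemma line_subset_flat: "subspace F \<Longrightarrow> v x \<in> F \<Longrightarrow> v i \<in> F \<Longrightarrow> line x i \<subseteq> flat v W F"
  by (intro flat_mono span_minimal) auto

text \<open>The lines through \<open>y\<close> partition the other vectors of the flat. If all were
  odd, each would contribute an even number, and with the simple point \<open>y\<close> the total
  would be odd, contrary to \<open>even_flat\<close>.\<close>

lemma exists_even_line:
  assumes F: "subspace F" and y: "y \<in> W" "v y \<in> F" "card (ray y) = 1" and big: "dim (v ` flat v W F) \<ge> 3"
  shows "\<exists>i\<in>flat v W F. v i \<notin> span {v y} \<and> even (card (line y i))"
proof (rule ccontr)
  assume none: "\<not> ?thesis"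
  define X where "X = flat v W F - ray y"
  define \<C> where "\<C> = (\<lambda>i. line y i - ray y) ` X"
  have X: "i \<in> W" "v i \<in> F" "v i \<notin> span {v y}" if "i \<in> X" for i using that by (auto simp: X_def mem_flat)
  have "\<Union>\<C> = X"
  proof
    show "\<Union>\<C> \<subseteq> X" using line_subset_flat[OF F y(2)] X by (auto simp: \<C>_def X_def)
    show "X \<subseteq> \<Union>\<C>" using X by (auto simp: \<C>_def mem_flat span_base)
  qed
  moreover have "2 dvd card (\<Union>\<C>)"
  proof (rule dvd_partition)
    show "finite (\<Union>\<C>)" using \<open>\<Union>\<C> = X\<close> fin by (simp add: X_def)
    show "\<forall>c\<in>\<C>. 2 dvd card c"
    proof
      fix c assume "c \<in> \<C>"
      then obtain i where i: "i \<in> X" "c = line y i - ray y" by (auto simp: \<C>_def)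
      then have "odd (card (line y i))" using none X[OF i(1)] by (auto simp: mem_flat)
      then show "2 dvd card c" using card_line[of y i] y(3) i(2) by simp
    qed
    show "\<forall>c1\<in>\<C>. \<forall>c2\<in>\<C>. c1 \<noteq> c2 \<longrightarrow> c1 \<inter> c2 = {}"
    proof (intro ballI impI)
      fix c1 c2 assume c: "c1 \<in> \<C>" "c2 \<in> \<C>" "c1 \<noteq> c2"
      then obtain i j where ij: "c1 = line y i - ray y" "c2 = line y j - ray y" by (auto simp: \<C>_def)
      show "c1 \<inter> c2 = {}"
      proof (rule ccontr)
        assume "c1 \<inter> c2 \<noteq> {}"
        then obtain k where k: "v k \<in> span {v y, v i}" "v k \<in> span {v y, v j}" "v k \<notin> span {v y}"
          using ij by (auto simp: mem_flat)
        then have "span {v y, v i} = span {v y, v j}" using span_pair_exchange by metis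
        then show False using ij c(3) by simp
      qed
    qed
  qed
  moreover have "card (flat v W F) = card X + card (ray y)"
    unfolding X_def by (rule card_flat_split[OF fin], rule span_minimal) (use F y in auto)
  ultimately have "odd (card (flat v W F))" using y(3) by simp
  then show False using even_flat[OF F big] by simp
qed

text \<open>A third even line through \<open>y\<close> leaves \<open>F\<close>: it is found in the
  plane through the odd line and \<open>w\<close>. Together with two different even lines inside
  \<open>F\<close> it would span rank \<open>4\<close>, against
  \<open>dim_even_lines_le_3\<close>.\<close>

lemma even_line_unique:
  assumes F: "subspace F" and w: "w \<in> W" "v w \<notin> F"
    and y: "y \<in> flat v W F" and l: "l \<in> flat v W F" "v l \<notin> span {v y}" "odd (card (line y l))"
    and i: "i \<in> flat v W F" "v i \<notin> span {v y}" "even (card (line y i))"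
    and j: "j \<in> flat v W F" "v j \<notin> span {v y}" "even (card (line y j))"
  shows "v j \<in> span {v y, v i}"
proof (rule ccontr)
  assume nj: "v j \<notin> span {v y, v i}"
  have inW: "y \<in> W" "l \<in> W" "i \<in> W" "j \<in> W" and inF: "v y \<in> F" "v l \<in> F" "v i \<in> F" "v j \<in> F"
    using y l i j by (auto simp: mem_flat)
  have one: "card (ray y) = 1" using card_ray_1_if_odd_line[OF inW(1) l(3)] .
  define G where "G = span {v y, v l, v w}"
  have ylF: "span {v y, v l} \<subseteq> F" by (rule span_minimal) (use F inF in auto)
  have "{v y, v l, v w} \<subseteq> v ` flat v W G" using inW w by (auto simp: mem_flat span_base G_def)
  moreover have "dim {v y, v l, v w} = 3"
    by (rule dim_triple) (use nz inW l w ylF in auto)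
  ultimately have "3 \<le> dim (v ` flat v W G)" by (metis dim_subset)
  then obtain m where m: "m \<in> flat v W G" "v m \<notin> span {v y}" "even (card (line y m))"
    using exists_even_line[of G y] inW one by (auto simp: G_def span_base)
  have mW: "m \<in> W" using m by (simp add: mem_flat)
  have "v m \<notin> span {v y, v l}"
  proof
    assume "v m \<in> span {v y, v l}"
    then have "span {v y, v m} = span {v y, v l}" using m(2) span_pair_exchange by blast
    then show False using m(3) l(3) by simp
  qed
  \<comment> \<open>\<open>G\<close> meets \<open>F\<close> only in the span of the odd line, and
    \<open>m\<close> is not on that line.\<close>
  have mF: "v m \<notin> F"
  proof
    assume vm: "v m \<in> F"
    have "v m \<in> span (insert (v w) {v y, v l})" using m(1) by (simp add: mem_flat G_def insert_commute)
    then have "v w \<in> span (insert (v m) {v y, v l})" using in_span_insert \<open>v m \<notin> span {v y, v l}\<close> by blast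
    also have "\<dots> \<subseteq> F" by (rule span_minimal) (use F inF vm in auto)
    finally show False using w by simp
  qed
  have "span {v y, v i, v j} \<subseteq> F" by (rule span_minimal) (use F inF in auto)
  then have "v m \<notin> span {v y, v i, v j}" using mF by blast
  then have "dim (insert (v m) {v y, v i, v j}) = dim {v y, v i, v j} + 1" by (simp add: dim_insert)
  also have "dim {v y, v i, v j} = 3" by (rule dim_triple) (use nz inW i nj in auto)
  finally have "dim (insert (v m) {v y, v i, v j}) = 4" by simp
  moreover have "dim (insert (v y) (v ` {i, j, m})) \<le> 3"
    by (rule dim_even_lines_le_3[OF inW(1) one]) (use inW mW i j m in auto)
  moreover have "insert (v m) {v y, v i, v j} = insert (v y) (v ` {i, j, m})" by auto
  ultimately show False by simp
qed

text \<open>Adjacency forces a jump of at least \<open>4\<close>, so the functional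
  \<open>u1\<close>, which is generic on the line, has the extreme value \<open>2\<close> there; the
  number of vectors has the same parity.\<close>

lemma even_line_if_adjacent:
  assumes s: "s \<in> W" and t: "t \<in> W" and st: "v t \<notin> span {v s}"
    and nb: "\<And>k \<alpha> \<beta>. k \<in> W \<Longrightarrow> v k = \<alpha> *\<^sub>R v s + \<beta> *\<^sub>R v t \<Longrightarrow> \<not> \<alpha> * \<beta> > 0"
  shows "even (card (line s t))"
proof -
  obtain u1 u2 where u1: "\<forall>i\<in>line s t. v i \<bullet> u1 \<noteq> 0"
    and d: "disc v (line s t) u1 - disc v (line s t) u2 \<ge> 2 * (int (card (ray s)) + int (card (ray t)))"
    using disc_jump_if_adjacent[of W v s t] fin af s t st nb by blast
  have "\<bar>disc v (line s t) u\<bar> \<le> 2" for u by (rule flat_bound[OF fin bound])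
  from this[of u1] this[of u2] have "disc v (line s t) u1 = 2"
    using d card_ray_pos[OF fin s, of v] card_ray_pos[OF fin t, of v] unfolding distrib_left by linarith
  then show ?thesis using disc_parity[of "line s t" v u1] u1 fin by auto
qed

text \<open>The ratio of \<open>h\<close> and \<open>g\<close> is an affine coordinate on the projective line through
  \<open>s\<close> and \<open>t\<close>, in which the points between them lie strictly between their coordinates.\<close>

lemma even_line_if_adjacent_coordinate:
  fixes g h :: 'a
  defines "\<tau> \<equiv> \<lambda>i. (v i \<bullet> h) / (v i \<bullet> g)"
  assumes s: "s \<in> W" and t: "t \<in> W" and pos: "(v s \<bullet> g) * (v t \<bullet> g) > 0" and ne: "\<tau> s \<noteq> \<tau> t"
    and nb: "\<And>k. k \<in> line s t \<Longrightarrow> v k \<bullet> g \<noteq> 0 \<Longrightarrow> \<not> (\<tau> k - \<tau> s) * (\<tau> k - \<tau> t) < 0"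
  shows "even (card (line s t))"
proof (rule even_line_if_adjacent[OF s t])
  show "v t \<notin> span {v s}"
  proof
    assume "v t \<in> span {v s}"
    then obtain c where c: "v t = c *\<^sub>R v s" by (auto simp: span_singleton)
    then have "c \<noteq> 0" using pos by auto
    then show False using ne by (simp add: \<tau>_def c)
  qed
  fix k \<alpha> \<beta> assume k: "k \<in> W" "v k = \<alpha> *\<^sub>R v s + \<beta> *\<^sub>R v t"
  show "\<not> \<alpha> * \<beta> > 0"
  proof
    assume ab: "\<alpha> * \<beta> > 0"
    \<comment> \<open>The coordinate of \<open>k\<close> is the mean of those of \<open>s\<close>
      and \<open>t\<close> with weights \<open>x\<close> and \<open>y\<close>, which have equal
      signs.\<close>
    define x where "x = \<alpha> * (v s \<bullet> g)"
    define y where "y = \<beta> * (v t \<bullet> g)"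
    have "x * y = (\<alpha> * \<beta>) * ((v s \<bullet> g) * (v t \<bullet> g))" by (simp add: x_def y_def)
    then have xy: "x * y > 0" using ab pos by simp
    have kg: "v k \<bullet> g = x + y" by (simp add: k x_def y_def inner_add_left)
    have xyn: "x + y \<noteq> 0" using xy by (auto simp: zero_less_mult_iff)
    have sg0: "v s \<bullet> g \<noteq> 0" "v t \<bullet> g \<noteq> 0" using pos by auto
    have kh: "v k \<bullet> h = x * \<tau> s + y * \<tau> t" using sg0 by (simp add: k x_def y_def inner_add_left \<tau>_def)
    have \<tau>k: "\<tau> k = (x * \<tau> s + y * \<tau> t) / (x + y)"
      using kg kh by (simp add: fun_cong[OF \<tau>_def[THEN meta_eq_to_obj_eq], of k])
    define \<delta> where "\<delta> = (\<tau> t - \<tau> s) / (x + y)"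
    have k_eq: "\<tau> k - \<tau> s = y * \<delta>" "\<tau> k - \<tau> t = - (x * \<delta>)"
      unfolding \<tau>k \<delta>_def using xyn by (simp_all add: divide_simps algebra_simps)
    have "(\<tau> k - \<tau> s) * (\<tau> k - \<tau> t) = - (x * y) * \<delta>\<^sup>2"
      unfolding k_eq by (simp add: power2_eq_square)
    also have "\<dots> < 0" using xy ne xyn by (intro mult_neg_pos) (auto simp: \<delta>_def)
    finally have "(\<tau> k - \<tau> s) * (\<tau> k - \<tau> t) < 0" .
    moreover have "k \<in> line s t" using k by (auto simp: mem_flat mem_span2)
    ultimately show False using nb kg xyn by simp
  qed
qed

text \<open>An odd line has discrepancy at most \<open>1\<close>. The point \<open>x\<close> already
  accounts for it, so nothing is left for functionals vanishing at \<open>x\<close>.\<close>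

lemma odd_line_balanced:
  assumes x: "x \<in> W" and odd: "odd (card (line x t))" and g: "v x \<bullet> g = 0"
  shows "disc v (line x t) g = 0"
proof -
  let ?X = "line x t"
  have "\<bar>disc v ?X u\<bar> \<le> 2" for u by (rule flat_bound[OF fin bound])
  then have b1: "\<bar>disc v ?X u\<bar> \<le> 1" for u
    using odd_card_bound[of ?X v u] fin nz odd by (auto simp: mem_flat)
  have "\<bar>disc v ?X g\<bar> + \<bar>disc v (flat v ?X (span {v x})) (v x)\<bar> \<le> 1"
    by (rule contraction_bound[of _ "{}"]) (use fin b1 g in auto)
  moreover have "flat v ?X (span {v x}) = ray x" by (rule flat_flat) (simp add: span_mono)
  ultimately show ?thesis using disc_ray[OF fin af x] card_ray_pos[OF fin x, of v] by simp
qed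

end

text \<open>Used to pick, in a balanced column, a vector on a prescribed side of the chart; the sign
  of \<open>c\<close> encodes the side.\<close>

lemma disc_0_both_signs:
  assumes "finite X" "disc v X g = 0" "t \<in> X" "v t \<bullet> g \<noteq> 0" "c \<noteq> 0"
  shows "\<exists>t'\<in>X. (v t' \<bullet> g) * c > 0"
proof (rule ccontr)
  assume none: "\<not> ?thesis"
  then have le: "(v i \<bullet> g) * c \<le> 0" if "i \<in> X" for i using that by force
  have le0: "0 \<le> - (sg (v i \<bullet> g) * sg c)" if "i \<in> X" for i
    using le[OF that] assms(5) by (auto simp: sg_def mult_le_0_iff zero_less_mult_iff)
  have "sg (v t \<bullet> g) * sg c \<noteq> 0" using assms by simp
  then have "0 < - (sg (v t \<bullet> g) * sg c)" using le0[OF assms(3)] by linarith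
  then have "(\<Sum>i\<in>X. - (sg (v i \<bullet> g) * sg c)) > 0"
    using le0 by (rule sum_pos2[OF assms(1,3)])
  then show False using assms(2) by (simp add: disc_def sum_negf flip: sum_distrib_right)
qed

text \<open>Among the values different from \<open>c\<close>, take one at least distance from
  \<open>c\<close>.\<close>

lemma exists_adjacent_value:
  fixes \<tau> :: "'i \<Rightarrow> real"
  assumes "finite K" "k \<in> K" "\<tau> k \<noteq> c"
  shows "\<exists>t\<in>K. \<tau> t \<noteq> c \<and> (\<forall>k\<in>K. \<not> (\<tau> k - c) * (\<tau> k - \<tau> t) < 0)"
proof -
  define J where "J = {k \<in> K. \<tau> k \<noteq> c}"
  have "finite J" "J \<noteq> {}" using assms by (auto simp: J_def)
  then obtain t where t: "t \<in> J" "\<And>k. k \<in> J \<Longrightarrow> \<bar>\<tau> t - c\<bar> \<le> \<bar>\<tau> k - c\<bar>"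
    using ex_min_if_finite[of "(\<lambda>k. \<bar>\<tau> k - c\<bar>) ` J"] by (metis (no_types, lifting) arg_min_least arg_min_if_finite(1))
  have "\<not> (\<tau> k - c) * (\<tau> k - \<tau> t) < 0" if "k \<in> K" for k
  proof
    assume neg: "(\<tau> k - c) * (\<tau> k - \<tau> t) < 0"
    then have "k \<in> J" using that by (auto simp: J_def)
    from t(2)[OF this] neg show False by (auto simp: mult_less_0_iff)
  qed
  then show ?thesis using t(1) by (auto simp: J_def)
qed

section \<open>Planes through an odd line\<close>

text \<open>The columns are the lines through \<open>p\<close>. With \<open>h\<close> vanishing on
  \<open>p\<close> and \<open>q\<close>, the common kernel of \<open>g\<close> and \<open>h\<close>
  in the plane is \<open>span {p}\<close>, so \<open>g\<close> and \<open>h\<close> are homogeneous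
  coordinates on the pencil at \<open>p\<close>.\<close>

lemma exists_column_coordinate:
  fixes p q r g :: "'a::euclidean_space"
  assumes r: "r \<notin> span {p, q}" and pg: "p \<bullet> g = 0" and qg: "q \<bullet> g \<noteq> 0"
  shows "\<exists>h. \<forall>y\<in>span {p, q, r}. \<forall>z\<in>span {p, q, r}. y \<bullet> g \<noteq> 0 \<longrightarrow> z \<bullet> g \<noteq> 0 \<longrightarrow>
    ((y \<bullet> h) / (y \<bullet> g) = (z \<bullet> h) / (z \<bullet> g) \<longleftrightarrow> z \<in> span {p, y})"
proof -
  obtain h where "\<forall>y\<in>span {p, q}. y \<bullet> h = 0" and rh: "r \<bullet> h = 1" using exists_perp[OF r] by blast
  then have ph: "p \<bullet> h = 0" and qh: "q \<bullet> h = 0" by (simp_all add: span_base)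
  have kernel: "x \<in> span {p}" if "x \<in> span {p, q, r}" "x \<bullet> g = 0" "x \<bullet> h = 0" for x
  proof -
    obtain \<alpha> \<beta> \<gamma> where x: "x = \<alpha> *\<^sub>R p + \<beta> *\<^sub>R q + \<gamma> *\<^sub>R r" using \<open>x \<in> span {p, q, r}\<close> by (auto simp: mem_span3)
    have "\<gamma> = 0" using that(3) ph qh rh by (simp add: x inner_add_left)
    moreover have "\<beta> = 0" using that(2) pg qg \<open>\<gamma> = 0\<close> by (simp add: x inner_add_left)
    ultimately show ?thesis by (simp add: x span_base span_scale)
  qed
  show ?thesis
  proof (intro exI ballI impI iffI)
    fix y z assume yz: "y \<in> span {p, q, r}" "z \<in> span {p, q, r}" "y \<bullet> g \<noteq> 0" "z \<bullet> g \<noteq> 0"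
    {
      assume eq: "(y \<bullet> h) / (y \<bullet> g) = (z \<bullet> h) / (z \<bullet> g)"
      define c where "c = (z \<bullet> g) / (y \<bullet> g)"
      have "z - c *\<^sub>R y \<in> span {p}"
      proof (rule kernel)
        show "z - c *\<^sub>R y \<in> span {p, q, r}" using yz by (intro span_diff span_scale)
        show "(z - c *\<^sub>R y) \<bullet> g = 0" using yz by (simp add: c_def inner_diff_left)
        show "(z - c *\<^sub>R y) \<bullet> h = 0" using yz eq by (simp add: c_def inner_diff_left field_simps)
      qed
      then have "z \<in> span (insert y {p})" unfolding span_breakdown_eq[of z y] by blast
      then show "z \<in> span {p, y}" by (simp add: insert_commute)
    }
    assume "z \<in> span {p, y}"
    then obtain \<alpha> \<beta> where z: "z = \<alpha> *\<^sub>R p + \<beta> *\<^sub>R y" by (auto simp: mem_span2)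
    then have "z \<bullet> g = \<beta> * (y \<bullet> g)" "z \<bullet> h = \<beta> * (y \<bullet> h)" using pg ph by (auto simp: inner_add_left)
    then show "(y \<bullet> h) / (y \<bullet> g) = (z \<bullet> h) / (z \<bullet> g)" using yz by auto
  qed
qed

text \<open>\<open>a\<close> and \<open>b\<close> span the odd line, \<open>f\<close> extends it to
  a plane \<open>F\<close>, and \<open>w\<close> lies outside \<open>F\<close> so that
  \<open>even_line_unique\<close> is available in the plane.\<close>

locale odd_line_flat = near_balanced v W for v :: "'i \<Rightarrow> 'a::euclidean_space" and W +
  fixes a b f w :: 'i
  assumes a: "a \<in> W" and b: "b \<in> W" and f: "f \<in> W" and w: "w \<in> W"
    and ab: "v b \<notin> span {v a}" and odd_ab: "odd (card (line a b))"
    and fL: "v f \<notin> span {v a, v b}" and wF: "v w \<notin> span {v a, v b, v f}"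
begin

definition "F = span {v a, v b, v f}"
text \<open>With the odd line at infinity, these vectors form the affine part of the plane.\<close>

definition "Y = flat v W F - line a b"
definition "universal y \<longleftrightarrow> (\<forall>k\<in>flat v W F. v k \<notin> span {v y} \<longrightarrow> even (card (line y k)))"

lemma ba: "v a \<notin> span {v b}"
  using not_in_span_sym[OF ab nz[OF a]] .

text \<open>Exchanging \<open>a\<close> and \<open>b\<close> turns columns, the lines through
  \<open>a\<close>, into rows, the lines through \<open>b\<close>, so statements about one pencil
  transfer to the other.\<close>

lemma swapped: "odd_line_flat v W b a f w"
  by unfold_locales (use a b f w ba odd_ab fL wF in \<open>auto simp: insert_commute\<close>)

lemma swapped_defs:
  "odd_line_flat.F v b a f = F" "odd_line_flat.Y v W b a f = Y"
  "odd_line_flat.universal v W b a f = universal"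
proof -
  interpret s: odd_line_flat v W b a f w by (rule swapped)
  show F: "s.F = F" by (simp add: s.F_def F_def insert_commute)
  show "s.Y = Y" by (simp add: s.Y_def Y_def F insert_commute)
  show "s.universal = universal" by (simp add: fun_eq_iff s.universal_def universal_def F)
qed

lemma subF: "subspace F"
  by (simp add: F_def)

lemma inF: "v a \<in> F" "v b \<in> F" "v f \<in> F"
  by (simp_all add: F_def span_base)

lemma in_flat: "a \<in> flat v W F" "b \<in> flat v W F" "f \<in> flat v W F"
  using a b f inF by (simp_all add: mem_flat)

lemma line_subset: "x \<in> flat v W F \<Longrightarrow> y \<in> flat v W F \<Longrightarrow> line x y \<subseteq> flat v W F"
  by (rule line_subset_flat[OF subF]) (auto simp: mem_flat)

lemma YD: "y \<in> Y \<Longrightarrow> y \<in> W" "y \<in> Y \<Longrightarrow> y \<in> flat v W F" "y \<in> Y \<Longrightarrow> v y \<in> F"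
  "y \<in> Y \<Longrightarrow> v y \<notin> span {v a, v b}"
  by (auto simp: Y_def mem_flat)

lemma Y_not_a: "y \<in> Y \<Longrightarrow> v y \<notin> span {v a}"
  using YD(4) span_mono[of "{v a}" "{v a, v b}"] by blast

lemma a_not_Y: "y \<in> Y \<Longrightarrow> v a \<notin> span {v y}"
  using not_in_span_sym[of "v y" "v a"] Y_not_a nz[OF a] by blast

lemma f_in_Y: "f \<in> Y"
  using in_flat fL by (simp add: Y_def mem_flat)

lemma card_ray_a: "card (ray a) = 1"
  using card_ray_1_if_odd_line[OF a odd_ab] .

lemma unique:
  assumes "y \<in> flat v W F" "l \<in> flat v W F" "v l \<notin> span {v y}" "odd (card (line y l))"
    "i \<in> flat v W F" "v i \<notin> span {v y}" "even (card (line y i))"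
    "j \<in> flat v W F" "v j \<notin> span {v y}" "even (card (line y j))"
  shows "v j \<in> span {v y, v i}"
  by (rule even_line_unique[OF subF w _ assms]) (use wF in \<open>simp add: F_def\<close>)

lemma unique_a:
  assumes "i \<in> Y" "even (card (line a i))" "j \<in> Y" "even (card (line a j))"
  shows "v j \<in> span {v a, v i}"
  by (rule unique[OF in_flat(1,2) ab odd_ab]) (use assms YD Y_not_a in auto)

lemma exists_chart: "\<exists>g. v a \<bullet> g = 0 \<and> v b \<bullet> g = 0 \<and> v f \<bullet> g \<noteq> 0 \<and> (\<forall>k\<in>flat v W F. v k \<bullet> g \<noteq> 0 \<longleftrightarrow> k \<in> Y)"
proof -
  obtain g where g: "\<forall>y\<in>span {v a, v b}. y \<bullet> g = 0" "v f \<bullet> g = 1" using exists_perp[OF fL] by blast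
  have "v k \<bullet> g \<noteq> 0" if kY: "k \<in> Y" for k
  proof -
    obtain \<alpha> \<beta> \<gamma> where k: "v k = \<alpha> *\<^sub>R v a + \<beta> *\<^sub>R v b + \<gamma> *\<^sub>R v f"
      using YD(3)[OF kY] by (auto simp: F_def mem_span3)
    have "\<gamma> \<noteq> 0"
    proof
      assume "\<gamma> = 0"
      then have "v k \<in> span {v a, v b}" using k by (auto simp: mem_span2)
      then show False using YD(4)[OF kY] by simp
    qed
    moreover have "v k \<bullet> g = \<gamma>" using g by (simp add: k inner_add_left span_base)
    ultimately show ?thesis by simp
  qed
  moreover have "k \<in> Y" if "k \<in> flat v W F" "v k \<bullet> g \<noteq> 0" for k
    using that g(1) by (auto simp: Y_def mem_flat)
  ultimately show ?thesis using g by (intro exI[of _ g]) (auto simp: span_base)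
qed

text \<open>If \<open>s'\<close> were on an odd line of the plane, its only even line there would be
  the column. But the nearest other column is odd, hence balanced, and contains some
  \<open>t'\<close> on the same side of the chart as \<open>s'\<close>. These two are adjacent, so
  their line is a second even one.\<close>

lemma universal_if_even_column:
  assumes s: "s \<in> Y" "even (card (line a s))" and k: "k \<in> Y" "v k \<notin> span {v a, v s}"
    and s': "s' \<in> Y" "v s' \<in> span {v a, v s}"
  shows "universal s'"
proof (rule ccontr)
  assume "\<not> universal s'"
  then obtain l where l: "l \<in> flat v W F" "v l \<notin> span {v s'}" "odd (card (line s' l))"
    by (auto simp: universal_def)
  obtain g where g: "v a \<bullet> g = 0" "v b \<bullet> g = 0" "v f \<bullet> g \<noteq> 0" "\<And>k. k \<in> flat v W F \<Longrightarrow> v k \<bullet> g \<noteq> 0 \<longleftrightarrow> k \<in> Y"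
    using exists_chart by blast
  have bf: "v b \<notin> span {v a, v f}"
  proof
    assume "v b \<in> span {v a, v f}"
    then have "v f \<in> span (insert (v b) {v a})" using ab in_span_insert[of "v b" "v f" "{v a}"] by (simp add: insert_commute)
    then show False using fL by (simp add: insert_commute)
  qed
  have Fe: "span {v a, v f, v b} = F" by (simp add: F_def insert_commute)
  obtain h where h: "\<forall>y\<in>F. \<forall>z\<in>F. y \<bullet> g \<noteq> 0 \<longrightarrow> z \<bullet> g \<noteq> 0 \<longrightarrow>
      ((y \<bullet> h) / (y \<bullet> g) = (z \<bullet> h) / (z \<bullet> g) \<longleftrightarrow> z \<in> span {v a, y})"
    using exists_column_coordinate[OF bf g(1,3)] unfolding Fe by blast
  define \<tau> where "\<tau> i = (v i \<bullet> h) / (v i \<bullet> g)" for i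
  have gY: "v i \<bullet> g \<noteq> 0" if "i \<in> Y" for i using that g(4) YD(2) by blast
  have \<tau>: "\<tau> i = \<tau> j \<longleftrightarrow> v j \<in> span {v a, v i}" if "i \<in> Y" "j \<in> Y" for i j
    using h YD(3) gY that unfolding \<tau>_def by blast
  have finY: "finite Y" using fin by (simp add: Y_def)
  have "\<tau> k \<noteq> \<tau> s" using \<tau>[OF s(1) k(1)] k(2) by auto
  then obtain t where t: "t \<in> Y" "\<tau> t \<noteq> \<tau> s" "\<And>k. k \<in> Y \<Longrightarrow> \<not> (\<tau> k - \<tau> s) * (\<tau> k - \<tau> t) < 0"
    using exists_adjacent_value[OF finY k(1)] by blast
  have \<tau>s': "\<tau> s' = \<tau> s" using \<tau>[OF s(1) s'(1)] s'(2) by simp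
  \<comment> \<open>There is only one even line through \<open>a\<close> in the plane, and
    \<open>t\<close> is not on it.\<close>
  have "odd (card (line a t))" using unique_a[OF s t(1)] \<tau>[OF s(1) t(1)] t(2) by metis
  then have "disc v (line a t) g = 0" using odd_line_balanced[OF a _ g(1)] by blast
  moreover have "t \<in> line a t" using YD(1)[OF t(1)] by (simp add: mem_flat span_base)
  ultimately obtain t' where t': "t' \<in> line a t" "(v t' \<bullet> g) * (v s' \<bullet> g) > 0"
    using disc_0_both_signs[of "line a t" v g t "v s' \<bullet> g"] fin gY t(1) s'(1) by auto
  have t'Y: "t' \<in> Y"
    using t' g(4) line_subset[OF in_flat(1) YD(2)[OF t(1)]] by (metis less_irrefl mult_zero_left subsetD)
  have \<tau>t': "\<tau> t' = \<tau> t" using \<tau>[OF t(1) t'Y] t'(1) by (simp add: mem_flat)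
  have "even (card (line s' t'))"
  proof (rule even_line_if_adjacent_coordinate[OF YD(1)[OF s'(1)] YD(1)[OF t'Y], of g h])
    show "(v s' \<bullet> g) * (v t' \<bullet> g) > 0" using t'(2) by (simp add: mult.commute)
    show "(v s' \<bullet> h) / (v s' \<bullet> g) \<noteq> (v t' \<bullet> h) / (v t' \<bullet> g)"
      using \<tau>s' \<tau>t' t(2) by (simp add: \<tau>_def)
    fix i assume i: "i \<in> line s' t'" "v i \<bullet> g \<noteq> 0"
    then have "i \<in> Y" using g(4) line_subset[OF YD(2)[OF s'(1)] YD(2)[OF t'Y]] by blast
    from t(3)[OF this] show "\<not> ((v i \<bullet> h) / (v i \<bullet> g) - (v s' \<bullet> h) / (v s' \<bullet> g)) * ((v i \<bullet> h) / (v i \<bullet> g) - (v t' \<bullet> h) / (v t' \<bullet> g)) < 0"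
      using \<tau>s' \<tau>t' by (simp add: \<tau>_def)
  qed
  moreover have "even (card (line s' a))"
    using span_pair_exchange[OF s'(2) Y_not_a[OF s'(1)]] s(2) by (simp add: insert_commute)
  moreover have t's': "v t' \<notin> span {v a, v s'}" using \<tau>[OF s'(1) t'Y] \<tau>s' \<tau>t' t(2) by simp
  then have "v t' \<notin> span {v s'}" using span_mono[of "{v s'}" "{v a, v s'}"] by blast
  ultimately have "v t' \<in> span {v s', v a}"
    using unique[OF YD(2)[OF s'(1)] l in_flat(1) a_not_Y[OF s'(1)] _ YD(2)[OF t'Y]] by blast
  then show False using t's' by (simp add: insert_commute)
qed

lemma even_line_a_if_universal: "y \<in> Y \<Longrightarrow> universal y \<Longrightarrow> even (card (line a y))"
  using a_not_Y in_flat(1) by (auto simp: universal_def line_commute[of a])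

text \<open>Two universal points share the unique even column and the unique even row, which meet in
  one projective point.\<close>

lemma universal_parallel:
  assumes y: "y \<in> Y" "universal y" and z: "z \<in> Y" "universal z"
  shows "v z \<in> span {v y}"
proof -
  interpret s: odd_line_flat v W b a f w by (rule swapped)
  have "v z \<in> span {v a, v y}"
    using unique_a[OF y(1) _ z(1)] even_line_a_if_universal y z by blast
  moreover have "v z \<in> span {v b, v y}"
    using s.unique_a[of y z] s.even_line_a_if_universal[of y] s.even_line_a_if_universal[of z] y z
    unfolding swapped_defs by blast
  ultimately obtain \<alpha> \<beta> \<gamma> \<delta> where e: "v z = \<alpha> *\<^sub>R v a + \<beta> *\<^sub>R v y" "v z = \<gamma> *\<^sub>R v b + \<delta> *\<^sub>R v y"
    unfolding mem_span2 by metis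
  have "\<alpha> *\<^sub>R v a + (- \<gamma>) *\<^sub>R v b + (\<beta> - \<delta>) *\<^sub>R v y = 0"
    using e by (simp add: algebra_simps)
  from independent3[OF ab YD(4)[OF y(1)] nz[OF a] this] e(1) show ?thesis by (simp add: span_base span_scale)
qed

text \<open>By \<open>par\<close>, the column consists of the simple point \<open>a\<close> and the
  point of \<open>s\<close>. Its total is even, so the multiplicity of \<open>s\<close> is odd, and
  it is at most \<open>2\<close>.\<close>

lemma card_ray_1_if_even_column:
  assumes s: "s \<in> Y" "even (card (line a s))"
    and par: "\<And>i. i \<in> Y \<Longrightarrow> v i \<in> span {v a, v s} \<Longrightarrow> v i \<in> span {v s}"
  shows "card (ray s) = 1"
proof -
  have "line a s = ray a \<union> ray s"
  proof
    show "line a s \<subseteq> ray a \<union> ray s"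
    proof
      fix i assume i: "i \<in> line a s"
      then have iW: "i \<in> W" "v i \<in> span {v a, v s}" by (auto simp: mem_flat)
      have iF: "i \<in> flat v W F" using i line_subset[OF in_flat(1) YD(2)[OF s(1)]] by blast
      show "i \<in> ray a \<union> ray s"
      proof (cases "i \<in> Y")
        case True then show ?thesis using par iW by (auto simp: mem_flat)
      next
        case False
        then have iL: "v i \<in> span {v a, v b}" using iF iW(1) by (auto simp: Y_def mem_flat)
        have "v i \<in> span {v a}"
        proof (rule ccontr)
          assume "v i \<notin> span {v a}"
          then have "span {v a, v s} = span {v a, v b}" using span_pair_exchange iW(2) iL by metis
          then show False using YD(4)[OF s(1)] by (metis insertI1 insert_commute span_base)
        qed
        then show ?thesis using iW by (simp add: mem_flat)
      qed
    qed
    show "ray a \<union> ray s \<subseteq> line a s" by (intro Un_least flat_mono span_mono) auto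
  qed
  moreover have "ray a \<inter> ray s = {}"
  proof (rule ccontr)
    assume "ray a \<inter> ray s \<noteq> {}"
    then obtain i where i: "i \<in> W" "v i \<in> span {v a}" "v i \<in> span {v s}" by (auto simp: mem_flat)
    obtain c where c: "v i = c *\<^sub>R v s" using i(3) by (auto simp: span_singleton)
    then have "c \<noteq> 0" using nz[OF i(1)] by auto
    then show False using i(2) c Y_not_a[OF s(1)] by (simp add: scaleR_mem_span_iff)
  qed
  ultimately have "card (line a s) = card (ray a) + card (ray s)" using fin by (simp add: card_Un_disjoint)
  then have "odd (card (ray s))" using card_ray_a s(2) by simp
  then show ?thesis using card_ray_le_2[OF YD(1)[OF s(1)]] by (metis One_nat_def Suc_1 even_numeral le_SucE le_zero_eq even_zero)
qed

text \<open>For a point on the given odd line this line itself serves, with \<open>a\<close> or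
  \<open>b\<close> as the other point.\<close>

lemma exists_odd_partner:
  assumes e: "e \<in> flat v W F" "e \<in> Y \<Longrightarrow> \<not> universal e"
  shows "\<exists>l\<in>flat v W F. v l \<notin> span {v e} \<and> odd (card (line e l))"
proof (cases "e \<in> Y")
  case True
  then show ?thesis using e by (auto simp: universal_def)
next
  case False
  then have eW: "e \<in> W" and eL: "v e \<in> span {v a, v b}" using e(1) by (auto simp: Y_def mem_flat)
  show ?thesis
  proof (cases "v e \<in> span {v a}")
    case True
    have "v e \<notin> span {v b}"
    proof
      assume eb: "v e \<in> span {v b}"
      obtain c where c: "v e = c *\<^sub>R v a" using True by (auto simp: span_singleton)
      then have "c \<noteq> 0" using nz[OF eW] by auto
      then show False using ba eb c by (simp add: scaleR_mem_span_iff)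
    qed
    moreover from this have "span {v b, v e} = span {v b, v a}"
      using eL by (intro span_pair_exchange) (simp_all add: insert_commute)
    then have "line e b = line a b" by (simp add: insert_commute)
    ultimately show ?thesis using not_in_span_sym[of "v e" "v b"] nz[OF b] odd_ab in_flat(2) by auto
  next
    case False
    then have "span {v a, v e} = span {v a, v b}" using eL by (intro span_pair_exchange)
    then have "line e a = line a b" by (simp add: insert_commute)
    then show ?thesis using not_in_span_sym[OF False nz[OF a]] odd_ab in_flat(1) by auto
  qed
qed

text \<open>The line from \<open>e\<close> to a universal point is even, and \<open>e\<close> also
  lies on an odd line because it is not universal itself. So this is the only even line through
  \<open>e\<close> in the plane.\<close>

lemma unique_via_universal:
  assumes y: "y \<in> Y" "universal y" and e: "e \<in> flat v W F" "v e \<notin> span {v y}"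
    and t: "t \<in> flat v W F" "v t \<notin> span {v e}" "even (card (line e t))"
  shows "v t \<in> span {v e, v y}"
proof -
  have "\<not> universal e" if "e \<in> Y" using universal_parallel[OF y that] e(2) by blast
  then obtain l where l: "l \<in> flat v W F" "v l \<notin> span {v e}" "odd (card (line e l))"
    using exists_odd_partner[OF e(1)] by blast
  have "even (card (line e y))" using y(2) e by (simp add: universal_def line_commute[of e])
  moreover have "v y \<notin> span {v e}" using not_in_span_sym[OF e(2) nz[OF YD(1)[OF y(1)]]] .
  ultimately show ?thesis using unique[OF e(1) l YD(2)[OF y(1)] _ _ t] by blast
qed

lemma dim_F: "dim F = 3"
  using dim_triple[OF nz[OF a] ab fL] by (simp add: F_def)

lemma exists_outside_plane_through:
  assumes y: "y \<in> Y" and k: "v k \<notin> span {v y}"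
  shows "\<exists>r\<in>flat v W F. v r \<notin> span {v y, v k}"
proof (rule ccontr)
  assume "\<not> ?thesis"
  then have ra: "v a \<in> span {v y, v k}" "v b \<in> span {v y, v k}" using in_flat by auto
  then have "span {v y, v a} = span {v y, v k}" using a_not_Y[OF y] by (intro span_pair_exchange)
  then have "v b \<in> span (insert (v y) {v a})" using ra by simp
  then have "v y \<in> span (insert (v b) {v a})" using ab in_span_insert by blast
  then show False using YD(4)[OF y] by (simp add: insert_commute)
qed

text \<open>Columns are now the lines through the universal point \<open>y\<close>. A vector
  \<open>e\<close> of this column on the same side of the chart as a vector \<open>t\<close> of the
  nearest other column would be adjacent to \<open>t\<close>, giving an even line through
  \<open>e\<close> other than the one to \<open>y\<close>. Hence the column off \<open>y\<close>
  lies on one side: it has at most \<open>2\<close> vectors by the discrepancy bound, and an odd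
  number by parity.\<close>

lemma card_universal_column:
  assumes y: "y \<in> Y" "universal y" "card (ray y) = 1" and k: "k \<in> flat v W F" "v k \<notin> span {v y}"
  shows "card (line y k - ray y) = 1"
proof -
  have yF: "y \<in> flat v W F" "y \<in> W" using YD y by auto
  obtain r where r: "r \<in> flat v W F" "v r \<notin> span {v y, v k}"
    using exists_outside_plane_through[OF y(1) k(2)] by blast
  obtain g where g: "\<forall>x\<in>span {v y}. x \<bullet> g = 0" "\<forall>i\<in>W. v i \<notin> span {v y} \<longrightarrow> v i \<bullet> g \<noteq> 0"
    using exists_generic_perp[OF fin, of "{v y}" v] by blast
  have Fe: "span {v y, v k, v r} = F"
  proof (rule subspace_dim_equal)
    show "span {v y, v k, v r} \<subseteq> F"
      by (rule span_minimal) (use yF k r subF in \<open>auto simp: mem_flat\<close>)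
    show "dim F \<le> dim (span {v y, v k, v r})"
      using dim_triple[OF nz[OF yF(2)] k(2) r(2)] dim_F by simp
  qed (simp_all add: subF)
  have yg: "v y \<bullet> g = 0" "v k \<bullet> g \<noteq> 0" using g k by (auto simp: span_base mem_flat)
  obtain h where h: "\<forall>y'\<in>F. \<forall>z\<in>F. y' \<bullet> g \<noteq> 0 \<longrightarrow> z \<bullet> g \<noteq> 0 \<longrightarrow>
      ((y' \<bullet> h) / (y' \<bullet> g) = (z \<bullet> h) / (z \<bullet> g) \<longleftrightarrow> z \<in> span {v y, y'})"
    using exists_column_coordinate[OF r(2) yg] unfolding Fe by blast
  define \<tau> where "\<tau> i = (v i \<bullet> h) / (v i \<bullet> g)" for i
  define K where "K = {i \<in> flat v W F. v i \<notin> span {v y}}"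
  have KD: "i \<in> flat v W F" "i \<in> W" "v i \<in> F" "v i \<notin> span {v y}" "v i \<bullet> g \<noteq> 0" if "i \<in> K" for i
    using that g(2) by (auto simp: K_def mem_flat)
  have \<tau>: "\<tau> i = \<tau> j \<longleftrightarrow> v j \<in> span {v y, v i}" if "i \<in> K" "j \<in> K" for i j
    using h KD(3,5) that unfolding \<tau>_def by blast
  have kK: "k \<in> K" using k by (simp add: K_def)
  have rK: "r \<in> K" using r span_mono[of "{v y}" "{v y, v k}"] by (auto simp: K_def)
  have finK: "finite K" using fin by (simp add: K_def)
  have "\<tau> r \<noteq> \<tau> k" using \<tau>[OF kK rK] r(2) by auto
  then obtain t where t: "t \<in> K" "\<tau> t \<noteq> \<tau> k" "\<And>i. i \<in> K \<Longrightarrow> \<not> (\<tau> i - \<tau> k) * (\<tau> i - \<tau> t) < 0"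
    using exists_adjacent_value[OF finK rK] by blast
  define P where "P = line y k - ray y"
  have neg: "(v e \<bullet> g) * (v t \<bullet> g) < 0" if e: "e \<in> P" for e
  proof (rule ccontr)
    have eK: "e \<in> K" using e line_subset[OF yF(1) k(1)] by (auto simp: P_def K_def mem_flat)
    have \<tau>e: "\<tau> e = \<tau> k" using \<tau>[OF kK eK] e by (simp add: P_def mem_flat)
    assume "\<not> (v e \<bullet> g) * (v t \<bullet> g) < 0"
    then have pos: "(v e \<bullet> g) * (v t \<bullet> g) > 0" using KD(5)[OF eK] KD(5)[OF t(1)]
      by (metis linorder_neqE_linordered_idom mult_eq_0_iff)
    have "even (card (line e t))"
    proof (rule even_line_if_adjacent_coordinate[OF KD(2)[OF eK] KD(2)[OF t(1)] pos, of h])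
      show "(v e \<bullet> h) / (v e \<bullet> g) \<noteq> (v t \<bullet> h) / (v t \<bullet> g)" using \<tau>e t(2) by (simp add: \<tau>_def)
      fix i assume i: "i \<in> line e t" "v i \<bullet> g \<noteq> 0"
      then have "i \<in> K" using line_subset[OF KD(1)[OF eK] KD(1)[OF t(1)]] g(1) by (auto simp: K_def)
      from t(3)[OF this] show "\<not> ((v i \<bullet> h) / (v i \<bullet> g) - (v e \<bullet> h) / (v e \<bullet> g)) * ((v i \<bullet> h) / (v i \<bullet> g) - (v t \<bullet> h) / (v t \<bullet> g)) < 0"
        using \<tau>e by (simp add: \<tau>_def)
    qed
    moreover have ne: "v t \<notin> span {v y, v e}" using \<tau>[OF eK t(1)] \<tau>e t(2) by simp
    then have "v t \<notin> span {v e}" using span_mono[of "{v e}" "{v y, v e}"] by blast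
    ultimately have "v t \<in> span {v e, v y}"
      using unique_via_universal[OF y(1,2) KD(1,4)[OF eK] KD(1)[OF t(1)]] by blast
    then show False using ne by (simp add: insert_commute)
  qed
  have "disc v (line y k) g = disc v P g"
    unfolding P_def by (rule disc_restrict_nonzero) (use fin g in \<open>auto simp: mem_flat\<close>)
  also have "\<dots> = (\<Sum>e\<in>P. - sg (v t \<bullet> g))"
    unfolding disc_def
  proof (rule sum.cong)
    show "sg (v e \<bullet> g) = - sg (v t \<bullet> g)" if "e \<in> P" for e
      using neg[OF that] by (auto simp: sg_def mult_less_0_iff)
  qed simp
  finally have "\<bar>disc v (line y k) g\<bar> = int (card P)"
    using KD(5)[OF t(1)] by (simp add: abs_mult abs_sg)
  then have "card P \<le> 2" using flat_bound[OF fin bound, of "{v y, v k}" g] by simp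
  moreover have "odd (card P)" using y(2,3) k card_line[of y k] by (auto simp: universal_def P_def)
  ultimately show ?thesis unfolding P_def[symmetric]
    by (metis One_nat_def Suc_1 even_numeral le_SucE le_zero_eq even_zero)
qed

text \<open>Without \<open>y\<close>, any two points of the plane have another one between them:
  their line misses \<open>y\<close>, so it is odd and its points cannot be adjacent. The remaining
  vectors therefore have rank at most \<open>2\<close>; as \<open>a\<close> and \<open>b\<close> are
  among them, all lie on the odd line.\<close>

lemma Y_singleton_if_universal:
  assumes y: "y \<in> Y" "universal y" "card (ray y) = 1"
  shows "Y = {y}"
proof -
  have yF: "y \<in> flat v W F" "y \<in> W" using YD y by auto
  have ray_y: "ray y = {y}" using y(3) self_in_ray[OF yF(2), of v] by (metis card_1_singletonE singletonD)
  define X where "X = flat v W F - {y}"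
  have XD: "i \<in> flat v W F" "i \<in> W" "v i \<notin> span {v y}" if "i \<in> X" for i
  proof -
    show "i \<in> flat v W F" and iW: "i \<in> W" using that by (auto simp: X_def mem_flat)
    have "i \<notin> ray y" using that unfolding ray_y by (simp add: X_def)
    then show "v i \<notin> span {v y}" using iW by (simp add: mem_flat)
  qed
  have "dim (v ` X) \<le> 2"
  proof (rule dim_le_2_if_between)
    show "finite X" using fin by (simp add: X_def)
    show "v i \<noteq> 0" if "i \<in> X" for i using nz XD(2)[OF that] .
    fix c d assume c: "c \<in> X" and d: "d \<in> X" and cd: "v d \<notin> span {v c}"
    have yc: "v y \<notin> span {v c}" using not_in_span_sym[OF XD(3)[OF c] nz[OF yF(2)]] .
    \<comment> \<open>A line through \<open>y\<close> carries only one further vector, so it cannot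
      contain both \<open>c\<close> and \<open>d\<close>.\<close>
    have ycd: "v y \<notin> span {v c, v d}"
    proof
      assume "v y \<in> span {v c, v d}"
      then have "span {v c, v y} = span {v c, v d}" using yc by (intro span_pair_exchange)
      then have "d \<in> line y c - ray y" "c \<in> line y c - ray y"
        using XD[OF c] XD[OF d] by (auto simp: mem_flat span_base insert_commute)
      moreover have "card (line y c - ray y) = 1" using card_universal_column[OF y XD(1,3)[OF c]] .
      ultimately have "d = c" by (metis card_1_singletonE singletonD)
      then show False using cd by (simp add: span_base)
    qed
    have "odd (card (line c d))"
    proof
      assume "even (card (line c d))"
      then have "v d \<in> span {v c, v y}"
        using unique_via_universal[OF y(1,2) XD(1,3)[OF c] XD(1)[OF d] cd] by blast
      then have "span {v c, v d} = span {v c, v y}" using cd by (intro span_pair_exchange)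
      then show False using ycd by (simp add: span_base)
    qed
    then obtain k \<alpha> \<beta> where k: "k \<in> W" "v k = \<alpha> *\<^sub>R v c + \<beta> *\<^sub>R v d" "\<alpha> * \<beta> > 0"
      using even_line_if_adjacent[OF XD(2)[OF c] XD(2)[OF d] cd] by blast
    have kcd: "v k \<in> span {v c, v d}" using k(2) by (auto simp: mem_span2)
    then have "k \<in> flat v W F" using k(1) line_subset[OF XD(1)[OF c] XD(1)[OF d]] by (auto simp: mem_flat)
    moreover have "k \<noteq> y" using kcd ycd by auto
    ultimately show "\<exists>k\<in>X. \<exists>\<alpha> \<beta>. \<alpha> * \<beta> > 0 \<and> v k = \<alpha> *\<^sub>R v c + \<beta> *\<^sub>R v d"
      using k by (auto simp: X_def)
  qed
  moreover have abX: "a \<in> X" "b \<in> X"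
    using in_flat YD(4)[OF y(1)] by (auto simp: X_def span_base)
  have "z = y" if z: "z \<in> Y" for z
  proof (rule ccontr)
    assume "z \<noteq> y"
    then have "{v a, v b, v z} \<subseteq> v ` X" using abX YD(2)[OF z] by (auto simp: X_def)
    then have "dim {v a, v b, v z} \<le> dim (v ` X)" by (rule dim_subset)
    then show False using dim_triple[OF nz[OF a] ab YD(4)[OF z]] \<open>dim (v ` X) \<le> 2\<close> by simp
  qed
  then show ?thesis using y(1) by blast
qed

lemma exists_even_column: "\<exists>s\<in>Y. even (card (line a s))"
proof -
  have "{v a, v b, v f} \<subseteq> v ` flat v W F" using in_flat by auto
  then have "3 \<le> dim (v ` flat v W F)" using dim_subset dim_triple[OF nz[OF a] ab fL] by metis
  then obtain s where s: "s \<in> flat v W F" "v s \<notin> span {v a}" "even (card (line a s))"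
    using exists_even_line[OF subF a inF(1) card_ray_a] by blast
  have "s \<notin> line a b"
  proof
    assume "s \<in> line a b"
    then have "span {v a, v s} = span {v a, v b}" using s(2) by (intro span_pair_exchange) (auto simp: mem_flat)
    then show False using s(3) odd_ab by simp
  qed
  then show ?thesis using s by (auto simp: Y_def)
qed

text \<open>All points of \<open>Y\<close> in the even column are universal, hence projectively
  equal. Parity makes this point simple, and a simple universal point is all of
  \<open>Y\<close>.\<close>

lemma Y_eq_if_two_columns:
  assumes s: "s \<in> Y" "even (card (line a s))" and k: "k \<in> Y" "v k \<notin> span {v a, v s}"
  shows "Y = {f}"
proof -
  have us: "universal i" if "i \<in> Y" "v i \<in> span {v a, v s}" for i
    using universal_if_even_column[OF s k that] .
  have s0: "universal s" using us[OF s(1)] by (simp add: span_base)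
  have "card (ray s) = 1"
    by (rule card_ray_1_if_even_column[OF s]) (use universal_parallel[OF s(1) s0] us in blast)
  then have "Y = {s}" using Y_singleton_if_universal[OF s(1) s0] by blast
  then show ?thesis using f_in_Y by auto
qed

text \<open>If \<open>Y\<close> meets two columns or two rows, the preceding lemma applies to one of
  the pencils. Otherwise \<open>Y\<close> lies in one column and one row, thus on a single
  projective point, which is simple by parity.\<close>

lemma Y_eq: "Y = {f}"
proof -
  interpret sw: odd_line_flat v W b a f w by (rule swapped)
  obtain s where s: "s \<in> Y" "even (card (line a s))" using exists_even_column by blast
  obtain s2 where s2: "s2 \<in> Y" "even (card (line b s2))"
    using sw.exists_even_column unfolding swapped_defs by blast
  consider k where "k \<in> Y" "v k \<notin> span {v a, v s}" | k where "k \<in> Y" "v k \<notin> span {v b, v s2}"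
    | "\<And>k. k \<in> Y \<Longrightarrow> v k \<in> span {v a, v s} \<and> v k \<in> span {v b, v s2}" by blast
  then show ?thesis
  proof cases
    case 1 then show ?thesis using Y_eq_if_two_columns[OF s] by blast
  next
    case 2 then show ?thesis using sw.Y_eq_if_two_columns[of s2] s2 unfolding swapped_defs by blast
  next
    case 3
    have "v s \<notin> span {v b}" using sw.Y_not_a s(1) unfolding swapped_defs by blast
    then have bs: "span {v b, v s} = span {v b, v s2}" using 3[OF s(1)] by (intro span_pair_exchange) auto
    have par: "v k \<in> span {v s}" if "k \<in> Y" for k
    proof -
      have "v k \<in> span {v a, v s}" "v k \<in> span {v b, v s}" using 3[OF that] bs by auto
      then obtain \<alpha> \<beta> \<gamma> \<delta> where e: "v k = \<alpha> *\<^sub>R v a + \<beta> *\<^sub>R v s" "v k = \<gamma> *\<^sub>R v b + \<delta> *\<^sub>R v s"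
        unfolding mem_span2 by metis
      have "\<alpha> *\<^sub>R v a + (- \<gamma>) *\<^sub>R v b + (\<beta> - \<delta>) *\<^sub>R v s = 0"
        using e by (simp add: algebra_simps)
      from independent3[OF ab YD(4)[OF s(1)] nz[OF a] this] e(1) show ?thesis by (simp add: span_base span_scale)
    qed
    have "card (ray s) = 1" by (rule card_ray_1_if_even_column[OF s par])
    then have "ray s = {s}" using self_in_ray[OF YD(1)[OF s(1)], of v] by (metis card_1_singletonE singletonD)
    then have "Y \<subseteq> {s}" using par YD(1) by (auto simp: mem_flat)
    then show ?thesis using f_in_Y by blast
  qed
qed

end

section \<open>Decompositions\<close>

context near_balanced
begin

text \<open>In the plane through the odd line \<open>L\<close> and a vector \<open>f\<close> of
  \<open>Z\<close>, no other vector lies off \<open>L\<close>, and the lines from \<open>a\<close>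
  and \<open>b\<close> to \<open>f\<close> are even. So \<open>Z\<close> has rank at most
  \<open>3\<close> together with \<open>a\<close>, and also with \<open>b\<close>, but at least
  \<open>4\<close> with both. The spans of \<open>L\<close> and \<open>Z\<close> are therefore
  complementary, and \<open>Z\<close> has the discrepancy of the contraction of
  \<open>L\<close>.\<close>

lemma split_if_dim_ge_4:
  assumes big: "dim (v ` W) \<ge> 4"
  shows "dim (v ` W) \<le> 4 \<and> (\<exists>L Z. L \<union> Z = W \<and> L \<inter> Z = {} \<and> odd (card L) \<and> card L \<ge> 2 \<and> card Z \<ge> 2 \<and>
    (\<forall>u. \<bar>disc v L u\<bar> \<le> 1) \<and> (\<forall>u. \<bar>disc v Z u\<bar> \<le> 1))"
proof -
  obtain a b where a: "a \<in> W" and b: "b \<in> W" and ab: "v b \<notin> span {v a}" and odd: "odd (card (line a b))"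
    using exists_odd_line[OF big] by blast
  define L where "L = line a b"
  define Z where "Z = W - L"
  have ba: "v a \<notin> span {v b}" using not_in_span_sym[OF ab nz[OF a]] .
  have odd': "odd (card (line b a))" using odd by (simp add: insert_commute)
  have fins: "finite L" "finite Z" using fin by (simp_all add: L_def Z_def)
  have ZD: "f \<in> W" "v f \<notin> span {v a, v b}" if "f \<in> Z" for f using that by (auto simp: Z_def L_def mem_flat)
  have ev: "even (card (line a f)) \<and> even (card (line b f))" if f: "f \<in> Z" for f
  proof -
    have "\<exists>w\<in>W. v w \<notin> span {v a, v b, v f}"
    proof (rule ccontr)
      assume "\<not> ?thesis"
      then have "v ` W \<subseteq> span {v a, v b, v f}" by auto
      then have "dim (v ` W) \<le> card {v a, v b, v f}" by (rule dim_le_card) simp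
      also have "\<dots> \<le> 3" by (simp add: card_insert_if)
      finally show False using big by simp
    qed
    then obtain w where w: "w \<in> W" "v w \<notin> span {v a, v b, v f}" by blast
    interpret p: odd_line_flat v W a b f w
      by unfold_locales (use a b ab odd ZD[OF f] w in auto)
    interpret q: odd_line_flat v W b a f w by (rule p.swapped)
    show ?thesis using p.exists_even_column q.exists_even_column p.Y_eq q.Y_eq by simp
  qed
  have not_par: "v f \<notin> span {v a}" "v f \<notin> span {v b}" if "f \<in> Z" for f
    using ZD(2)[OF that] span_mono[of "{v a}" "{v a, v b}"] span_mono[of "{v b}" "{v a, v b}"] by auto
  have da: "dim (insert (v a) (v ` Z)) \<le> 3"
    by (rule dim_even_lines_le_3[OF a card_ray_1_if_odd_line[OF a odd]]) (use ev not_par ZD in auto)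
  have db: "dim (insert (v b) (v ` Z)) \<le> 3"
    by (rule dim_even_lines_le_3[OF b card_ray_1_if_odd_line[OF b odd']]) (use ev not_par ZD in auto)
  have "v ` W \<subseteq> span (insert (v a) (insert (v b) (v ` Z)))"
  proof clarify
    fix i assume "i \<in> W"
    then show "v i \<in> span (insert (v a) (insert (v b) (v ` Z)))"
      using span_mono[of "{v a, v b}" "insert (v a) (insert (v b) (v ` Z))"]
      by (cases "v i \<in> span {v a, v b}") (auto simp: Z_def L_def mem_flat intro: span_base)
  qed
  note spn = this
  then have "dim (v ` W) \<le> dim (insert (v a) (insert (v b) (v ` Z)))" by (metis dim_span dim_subset)
  then have d4: "dim (insert (v a) (insert (v b) (v ` Z))) \<ge> 4" using big by simp
  have ia: "v a \<notin> span (insert (v b) (v ` Z))"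
    using d4 db dim_insert[of "v a" "insert (v b) (v ` Z)"] by auto
  have ib: "v b \<notin> span (insert (v a) (v ` Z))"
    using d4 da dim_insert[of "v b" "insert (v a) (v ` Z)"] by (auto simp: insert_commute)
  obtain p where p0: "\<forall>y\<in>span (insert (v b) (v ` Z)). y \<bullet> p = 0" and pa: "v a \<bullet> p = 1" using exists_perp[OF ia] by blast
  obtain q where q0: "\<forall>y\<in>span (insert (v a) (v ` Z)). y \<bullet> q = 0" and qb: "v b \<bullet> q = 1" using exists_perp[OF ib] by blast
  have pb: "v b \<bullet> p = 0" and qa: "v a \<bullet> q = 0" using p0 q0 by (simp_all add: span_base)
  have pZ: "v i \<bullet> p = 0" and qZ: "v i \<bullet> q = 0" if "i \<in> Z" for i using p0 q0 that by (simp_all add: span_base)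
  have "\<bar>disc v Z u\<bar> \<le> 1" for u
  proof -
    \<comment> \<open>Subtracting multiples of \<open>p\<close> and \<open>q\<close> makes the
      functional vanish on \<open>L\<close> and keeps its values on \<open>Z\<close>.\<close>
    define u' where "u' = u - (v a \<bullet> u) *\<^sub>R p - (v b \<bullet> u) *\<^sub>R q"
    have u'a: "v a \<bullet> u' = 0" and u'b: "v b \<bullet> u' = 0"
      using pa pb qa qb by (simp_all add: u'_def inner_diff_right)
    have u'Z: "v i \<bullet> u' = v i \<bullet> u" if "i \<in> Z" for i
      using pZ[OF that] qZ[OF that] by (simp add: u'_def inner_diff_right)
    have "disc v W u' = disc v Z u'"
    proof (rule disc_restrict_nonzero[OF fin])
      show "Z \<subseteq> W" by (auto simp: Z_def)
      fix i assume "i \<in> W" "i \<notin> Z"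
      then have "v i \<in> span {v a, v b}" by (auto simp: Z_def L_def mem_flat)
      then show "v i \<bullet> u' = 0" by (rule span_perp[rotated]) (use u'a u'b in auto)
    qed
    also have "\<dots> = disc v Z u" unfolding disc_def by (rule sum.cong) (use u'Z in auto)
    finally show ?thesis using odd_line_contraction[OF odd u'a u'b] by simp
  qed
  moreover have "\<bar>disc v L u\<bar> \<le> 1" for u
    using odd_card_bound[of L v u] fins nz odd flat_bound[OF fin bound] by (auto simp: L_def mem_flat)
  moreover have "card L \<ge> 2"
  proof -
    have "a \<noteq> b" using ab by (auto simp: span_base)
    moreover have "{a, b} \<subseteq> L" using a b by (auto simp: L_def mem_flat span_base)
    ultimately show ?thesis using card_mono[OF fins(1), of "{a, b}"] by simp
  qed
  moreover have "card Z \<ge> 2"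
  proof -
    have "dim (v ` W) \<le> card (insert (v a) (insert (v b) (v ` Z)))"
      by (rule dim_le_card[OF spn]) (use fins in simp)
    also have "\<dots> \<le> Suc (Suc (card (v ` Z)))" using fins by (simp add: card_insert_if)
    also have "\<dots> \<le> Suc (Suc (card Z))" using card_image_le[OF fins(2)] by simp
    finally show ?thesis using big by simp
  qed
  moreover have "L \<union> Z = W" "L \<inter> Z = {}" by (auto simp: L_def Z_def mem_flat)
  ultimately show ?thesis using dim_le_4_if_odd_line[OF a b ab odd] odd
    by (intro conjI exI[of _ L] exI[of _ Z]) (auto simp: L_def)
qed

end

section \<open>Covector discrepancy and dual codegree in terms of \<open>disc\<close>\<close>

lemma linear_functional_inner:
  fixes f :: "'a::euclidean_space \<Rightarrow> real"
  assumes "linear f"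
  shows "f = (\<lambda>x. x \<bullet> adjoint f 1)"
  using adjoint_works[OF assms, of _ 1] by (simp add: fun_eq_iff)

lemma disc_eq_card_diff:
  assumes "finite W"
  shows "disc v W u = int (card {i \<in> W. v i \<bullet> u > 0}) - int (card {i \<in> W. v i \<bullet> u < 0})"
proof -
  have "disc v W u = (\<Sum>i\<in>W. (if v i \<bullet> u > 0 then 1 else 0) - (if v i \<bullet> u < 0 then 1 else 0))"
    unfolding disc_def by (rule sum.cong) (auto simp: sg_def)
  also have "\<dots> = (\<Sum>i\<in>{i \<in> W. v i \<bullet> u > 0}. 1) - (\<Sum>i\<in>{i \<in> W. v i \<bullet> u < 0}. 1)"
    unfolding sum_subtractf sum.inter_filter[OF assms] ..
  finally show ?thesis by simp
qed

lemma abs_disc_le_card: "finite W \<Longrightarrow> \<bar>disc v W u\<bar> \<le> int (card W)"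
proof -
  have "\<bar>disc v W u\<bar> \<le> (\<Sum>i\<in>W. \<bar>sg (v i \<bullet> u)\<bar>)" unfolding disc_def by (rule sum_abs)
  also have "\<dots> \<le> (\<Sum>i\<in>W. 1)" by (rule sum_mono) (simp add: abs_sg)
  finally show ?thesis by simp
qed

lemma covector_discrepancy_eq_Max:
  fixes v :: "'i \<Rightarrow> 'a::euclidean_space"
  assumes "finite W"
  shows "covector_discrepancy v W = Max (range (\<lambda>u. nat \<bar>disc v W u\<bar>))"
proof -
  have "(\<lambda>f. nat \<bar>int (card {i \<in> W. f (v i) > (0::real)}) - int (card {i \<in> W. f (v i) < 0})\<bar>) ` {f. linear f}
    = range (\<lambda>u. nat \<bar>disc v W u\<bar>)" (is "?P = ?R")
  proof
    show "?P \<subseteq> ?R"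
    proof clarify
      fix f :: "'a \<Rightarrow> real" assume "linear f"
      then obtain u where u: "f = (\<lambda>x. x \<bullet> u)" using linear_functional_inner by blast
      show "nat \<bar>int (card {i \<in> W. f (v i) > 0}) - int (card {i \<in> W. f (v i) < 0})\<bar> \<in> ?R"
        unfolding u disc_eq_card_diff[OF assms] by blast
    qed
    show "?R \<subseteq> ?P"
    proof clarify
      fix u :: 'a
      have "linear (\<lambda>x. x \<bullet> u)" by (simp add: bounded_linear.linear bounded_linear_inner_left)
      then show "nat \<bar>disc v W u\<bar> \<in> ?P" unfolding disc_eq_card_diff[OF assms] by (intro image_eqI[of _ _ "\<lambda>x. x \<bullet> u"]) auto
    qed
  qed
  then show ?thesis unfolding covector_discrepancy_def by simp
qed

lemma finite_disc_values: "finite W \<Longrightarrow> finite (range (\<lambda>u. nat \<bar>disc v W u\<bar>))"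
  by (rule finite_subset[of _ "{..card W}"]) (use abs_disc_le_card[of W v] in \<open>auto simp: nat_le_iff\<close>)

lemma abs_disc_le_covector_discrepancy:
  assumes "finite W" shows "\<bar>disc v W u\<bar> \<le> int (covector_discrepancy v W)"
proof -
  have "nat \<bar>disc v W u\<bar> \<le> covector_discrepancy v W"
    unfolding covector_discrepancy_eq_Max[OF assms] by (rule Max_ge[OF finite_disc_values[OF assms]]) simp
  then show ?thesis by linarith
qed

lemma covector_discrepancy_attained:
  assumes "finite W" shows "\<exists>u. disc v W u = int (covector_discrepancy v W)"
proof -
  have "covector_discrepancy v W \<in> range (\<lambda>u. nat \<bar>disc v W u\<bar>)"
    unfolding covector_discrepancy_eq_Max[OF assms] by (rule Max_in[OF finite_disc_values[OF assms]]) simp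
  then obtain u where "covector_discrepancy v W = nat \<bar>disc v W u\<bar>" by blast
  then have "disc v W u = int (covector_discrepancy v W) \<or> disc v W (- u) = int (covector_discrepancy v W)" by auto
  then show ?thesis by blast
qed

lemma covector_discrepancy_le:
  assumes "finite W" "\<And>u. \<bar>disc v W u\<bar> \<le> int d"
  shows "covector_discrepancy v W \<le> d"
  using covector_discrepancy_attained[OF assms(1), of v] assms(2) by (metis abs_of_nat of_nat_le_iff)

lemma card_sign_split:
  assumes "finite W"
  shows "card W = card {i \<in> W. v i \<bullet> u > 0} + card {i \<in> W. v i \<bullet> u \<le> 0}"
proof -
  have "W = {i \<in> W. v i \<bullet> u > 0} \<union> {i \<in> W. v i \<bullet> u \<le> 0}" by auto
  then show ?thesis using assms card_Un_disjoint[of "{i \<in> W. v i \<bullet> u > 0}" "{i \<in> W. v i \<bullet> u \<le> 0}"] by force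
qed

text \<open>A functional with \<open>c\<close> nonpositive values has signed count at least
  \<open>card W - 2 * c\<close>, with equality if no value is zero. A maximiser of
  \<open>disc\<close> can be made generic without losing the maximum.\<close>

lemma codeg_star_formula:
  fixes v :: "'i \<Rightarrow> 'a::euclidean_space"
  assumes fin: "finite W" and nz: "\<And>i. i \<in> W \<Longrightarrow> v i \<noteq> 0"
  shows "2 * codeg_star v W + covector_discrepancy v W = card W"
proof -
  let ?V = "(\<lambda>f. card {i \<in> W. f (v i) \<le> (0::real)}) ` {f. linear f \<and> f \<noteq> (\<lambda>x. 0)}"
  have finV: "finite ?V"
    by (rule finite_subset[of _ "{..card W}"]) (use fin in \<open>auto intro: card_mono\<close>)
  have lower: "card W \<le> 2 * c + covector_discrepancy v W" if cV: "c \<in> ?V" for c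
  proof -
    obtain f where f: "linear f" "c = card {i \<in> W. f (v i) \<le> (0::real)}" using cV by blast
    obtain u where u: "f = (\<lambda>x. x \<bullet> u)" using linear_functional_inner[OF f(1)] by blast
    have c: "c = card {i \<in> W. v i \<bullet> u \<le> 0}" using f u by simp
    have "card {i \<in> W. v i \<bullet> u < 0} \<le> c" unfolding c by (rule card_mono) (use fin in auto)
    then show ?thesis
      using card_sign_split[OF fin, of v u] disc_eq_card_diff[OF fin, of v u]
        abs_disc_le_covector_discrepancy[OF fin, of v u] c by linarith
  qed
  have "\<exists>u. (\<forall>i\<in>W. v i \<bullet> u \<noteq> 0) \<and> disc v W u = int (covector_discrepancy v W)"
  proof -
    obtain u where u: "disc v W u = int (covector_discrepancy v W)"
      using covector_discrepancy_attained[OF fin] by blast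
    obtain u0 where u0: "\<forall>i\<in>W. v i \<bullet> u0 \<noteq> 0"
      using exists_generic_perp[OF fin, of "{}" v] nz by auto
    \<comment> \<open>The sign of the generic direction is chosen so that the perturbation does not
      lower the discrepancy.\<close>
    define h where "h = (if disc v {i \<in> W. v i \<bullet> u = 0} u0 \<ge> 0 then u0 else - u0)"
    have h: "disc v {i \<in> W. v i \<bullet> u = 0} h \<ge> 0" "\<And>i. i \<in> W \<Longrightarrow> v i \<bullet> h \<noteq> 0" using u0 by (auto simp: h_def)
    obtain e where e: "\<forall>i\<in>W. sg (v i \<bullet> (u + e *\<^sub>R h)) = (if v i \<bullet> u = 0 then sg (v i \<bullet> h) else sg (v i \<bullet> u))"
      using perturb[OF fin] by blast
    have "disc v W (u + e *\<^sub>R h) = disc v W u + disc v {i \<in> W. v i \<bullet> u = 0} h"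
      by (rule disc_perturb[OF fin]) (use e in auto)
    then have "disc v W (u + e *\<^sub>R h) = int (covector_discrepancy v W)"
      using u h(1) abs_disc_le_covector_discrepancy[OF fin, of v "u + e *\<^sub>R h"] by linarith
    moreover have "v i \<bullet> (u + e *\<^sub>R h) \<noteq> 0" if "i \<in> W" for i
    proof -
      have "sg (v i \<bullet> (u + e *\<^sub>R h)) \<noteq> 0" using e h(2)[OF that] that by auto
      then show ?thesis by auto
    qed
    ultimately show ?thesis by blast
  qed
  then obtain u where u: "\<forall>i\<in>W. v i \<bullet> u \<noteq> 0" "disc v W u = int (covector_discrepancy v W)" by blast
  \<comment> \<open>For empty \<open>W\<close> the vector \<open>u\<close> may be zero and define no
    hyperplane; a basis vector replaces it.\<close>
  define u1 where "u1 = (if W = {} then SOME i. i \<in> Basis else u)"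
  have u1: "\<forall>i\<in>W. v i \<bullet> u1 \<noteq> 0" "disc v W u1 = int (covector_discrepancy v W)"
    using u by (auto simp: u1_def)
  have "u1 \<noteq> 0"
  proof (cases "W = {}")
    case True then show ?thesis using nonzero_Basis[OF SOME_Basis] by (simp add: u1_def)
  next
    case False then show ?thesis using u1(1) by auto
  qed
  define c where "c = card {i \<in> W. v i \<bullet> u1 \<le> 0}"
  have "{i \<in> W. v i \<bullet> u1 < 0} = {i \<in> W. v i \<bullet> u1 \<le> 0}" using u1(1) by force
  then have c_eq: "2 * c + covector_discrepancy v W = card W"
    using card_sign_split[OF fin, of v u1] disc_eq_card_diff[OF fin, of v u1] u1(2) by (simp add: c_def)
  have "linear (\<lambda>x. x \<bullet> u1)" by (simp add: bounded_linear.linear bounded_linear_inner_left)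
  moreover have "(\<lambda>x. x \<bullet> u1) \<noteq> (\<lambda>x. 0)" using \<open>u1 \<noteq> 0\<close> by (metis inner_eq_zero_iff)
  ultimately have cV: "c \<in> ?V" unfolding c_def by (intro image_eqI[of _ _ "\<lambda>x. x \<bullet> u1"]) simp_all
  then have "codeg_star v W \<in> ?V" unfolding codeg_star_def using finV by (intro Min_in) auto
  then have "card W \<le> 2 * codeg_star v W + covector_discrepancy v W" by (rule lower)
  moreover have "codeg_star v W \<le> c" unfolding codeg_star_def by (rule Min_le[OF finV cV])
  ultimately show ?thesis using c_eq by linarith
qed

text \<open>The required length, a truncated difference, never exceeds \<open>2\<close>. Length
  \<open>2\<close> is required only for discrepancy \<open>2\<close> and rank \<open>4\<close>,
  where the odd line and its complement are two parts of discrepancy \<open>1\<close>.\<close>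

lemma decomposition_antipodal_free:
  assumes fin: "finite W" and af: "antipodal_free v W" and cd: "covector_discrepancy v W \<le> 2"
  shows "\<exists>m Vs. m \<ge> dim (v ` W) - covector_discrepancy v W \<and> codeg_star_decomposition v W Vs m"
proof -
  let ?d = "covector_discrepancy v W"
  have disc_le: "\<bar>disc v W u\<bar> \<le> int ?d" for u by (rule abs_disc_le_covector_discrepancy[OF fin])
  have nz: "v i \<noteq> 0" if "i \<in> W" for i using antipodal_free_nonzero[OF af that] .
  note formula = codeg_star_formula[of W v, OF fin nz]
  have "\<bar>disc v W u\<bar> \<le> 2" for u using disc_le[of u] cd by linarith
  then interpret near_balanced v W by unfold_locales (use fin af in auto)
  consider "codeg_star v W = 0" | "codeg_star v W \<ge> 1" "dim (v ` W) - ?d \<le> 1" | "dim (v ` W) - ?d \<ge> 2"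
    by linarith
  then show ?thesis
  proof cases
    case 1
    have "dim (v ` W) \<le> card W"
      using dim_le_card'[of "v ` W"] card_image_le[OF fin, of v] fin by (meson finite_imageI order_trans)
    \<comment> \<open>Here the formula gives \<open>card W = ?d\<close>, which bounds the rank. All
      of \<open>W\<close> goes into the part with index \<open>0\<close>, which enters no
      sum.\<close>
    then have "codeg_star_decomposition v W (\<lambda>_. W) 0 \<and> dim (v ` W) - ?d = 0"
      using 1 formula by (simp add: codeg_star_decomposition_def)
    then show ?thesis by (metis order_refl)
  next
    case 2
    have "codeg_star_decomposition v W (\<lambda>k. if k = 1 then W else {}) 1"
      using 2 by (auto simp: codeg_star_decomposition_def le_Suc_eq)
    then show ?thesis using 2 by blast
  next
    case 3
    \<comment> \<open>A smaller discrepancy bounds the rank by \<open>2\<close>, so it would have to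
      be \<open>0\<close>; but a single ray already has positive discrepancy.\<close>
    have "?d = 2"
    proof (rule ccontr)
      assume "?d \<noteq> 2"
      then have d1: "?d \<le> 1" using cd by simp
      have b1: "\<bar>disc v W u\<bar> \<le> 1" for u using disc_le[of u] d1 by linarith
      have "dim (v ` W) \<le> 2" by (rule dim_le_2_if_disc_le_1[OF fin af b1])
      then have "?d = 0" using 3 by linarith
      have "W = {}"
      proof (rule ccontr)
        assume "W \<noteq> {}"
        then obtain x where x: "x \<in> W" by blast
        have "\<bar>disc v (ray x) (v x)\<bar> \<le> 0" by (rule flat_bound[OF fin]) (use disc_le \<open>?d = 0\<close> in simp)
        then show False using disc_ray[OF fin af x] card_ray_pos[OF fin x, of v] by simp
      qed
      then show False using 3 by simp
    qed
    then have big: "dim (v ` W) \<ge> 4" using 3 by linarith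
    obtain L Z where LZ: "L \<union> Z = W" "L \<inter> Z = {}" "odd (card L)" "card L \<ge> 2" "card Z \<ge> 2"
      "\<And>u. \<bar>disc v L u\<bar> \<le> 1" "\<And>u. \<bar>disc v Z u\<bar> \<le> 1" and "dim (v ` W) \<le> 4"
      using split_if_dim_ge_4[OF big] by blast
    have fins: "finite L" "finite Z" using fin LZ(1) by auto
    have cL: "2 * codeg_star v L + covector_discrepancy v L = card L" "covector_discrepancy v L \<le> 1"
      by (rule codeg_star_formula[OF fins(1)], use nz LZ(1) in blast, rule covector_discrepancy_le[OF fins(1)], use LZ(6) in simp)
    have cZ: "2 * codeg_star v Z + covector_discrepancy v Z = card Z" "covector_discrepancy v Z \<le> 1"
      by (rule codeg_star_formula[OF fins(2)], use nz LZ(1) in blast, rule covector_discrepancy_le[OF fins(2)], use LZ(7) in simp)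
    have "card W = card L + card Z" using card_Un_disjoint[OF fins LZ(2)] LZ(1) by simp
    then have total: "2 * codeg_star v W + 2 = card L + card Z" using formula \<open>?d = 2\<close> by simp
    have pos: "codeg_star v L \<ge> 1" "codeg_star v Z \<ge> 1" using cL cZ LZ(4,5) by linarith+
    \<comment> \<open>By the formula the discrepancy of \<open>L\<close> is odd like its
      cardinality; for \<open>Z\<close> the same follows from the parity of the total.\<close>
    have "covector_discrepancy v L = 1" using cL LZ(3) by presburger
    moreover have "covector_discrepancy v Z = 1" using cZ cL(1) total calculation by presburger
    ultimately have "codeg_star v W = codeg_star v L + codeg_star v Z" using total cL(1) cZ(1) by linarith
    then have "codeg_star_decomposition v W (\<lambda>k. if k = 1 then L else if k = 2 then Z else {}) 2"
      using LZ(1,2) pos by (auto simp: codeg_star_decomposition_def numeral_2_eq_2 le_Suc_eq)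
    moreover have "dim (v ` W) - ?d \<le> 2" using \<open>dim (v ` W) \<le> 4\<close> \<open>?d = 2\<close> by simp
    ultimately show ?thesis by blast
  qed
qed

lemma decomposition_add_pair:
  assumes dec: "codeg_star_decomposition v W Vs m" and P: "W \<inter> P = {}"
    and "codeg_star v (W \<union> P) = codeg_star v W + codeg_star v P" "codeg_star v P \<ge> 1"
  shows "codeg_star_decomposition v (W \<union> P) (Vs(Suc m := P)) (Suc m)"
proof -
  let ?V = "Vs(Suc m := P)"
  have V: "\<And>k. k \<le> m \<Longrightarrow> ?V k = Vs k" "?V (Suc m) = P" by auto
  have d: "\<forall>k\<le>m. Vs k \<subseteq> W" "(\<Union>k\<le>m. Vs k) = W" "\<forall>k\<le>m. \<forall>l\<le>m. k \<noteq> l \<longrightarrow> Vs k \<inter> Vs l = {}"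
    "codeg_star v W = (\<Sum>k=1..m. codeg_star v (Vs k))" "\<forall>k\<in>{1..m}. codeg_star v (Vs k) \<ge> 1"
    using dec unfolding codeg_star_decomposition_def by auto
  have "(\<Union>k\<le>Suc m. ?V k) = W \<union> P"
    unfolding atMost_Suc UN_insert V(2) d(2)[symmetric] using V(1) by auto
  moreover have "(\<Sum>k=1..Suc m. codeg_star v (?V k)) = (\<Sum>k=1..m. codeg_star v (Vs k)) + codeg_star v P"
    by simp
  moreover have "?V k \<inter> ?V l = {}" if "k \<le> Suc m" "l \<le> Suc m" "k \<noteq> l" for k l
    using that d(1,3) P by (cases "k = Suc m"; cases "l = Suc m") (force simp: le_Suc_eq)+
  moreover have "?V k \<subseteq> W \<union> P" if "k \<le> Suc m" for k
    using that d(1) by (cases "k = Suc m") (auto simp: le_Suc_eq)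
  moreover have "codeg_star v (?V k) \<ge> 1" if "k \<in> {1..Suc m}" for k
    using that d(5) assms(4) by (cases "k = Suc m") auto
  ultimately show ?thesis unfolding codeg_star_decomposition_def using assms(3) d(4) by auto
qed

text \<open>An antipodal pair has discrepancy \<open>0\<close> and dual codegree \<open>1\<close>.
  Splitting it off keeps the discrepancy and lowers the rank by at most \<open>1\<close>, which the
  additional part makes up for.\<close>

lemma decomposition_exists:
  assumes "finite W" "\<And>i. i \<in> W \<Longrightarrow> v i \<noteq> 0" "covector_discrepancy v W \<le> 2"
  shows "\<exists>m Vs. m \<ge> dim (v ` W) - covector_discrepancy v W \<and> codeg_star_decomposition v W Vs m"
  using assms
proof (induction W rule: finite_psubset_induct)
  case (psubset W)
  show ?case
  proof (cases "antipodal_free v W")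
    case True
    then show ?thesis using decomposition_antipodal_free psubset by blast
  next
    case False
    obtain i j t where ij: "i \<in> W" "j \<in> W" "i \<noteq> j" "t > 0" "v j = - (t *\<^sub>R v i)"
      using not_antipodal_free_pair[OF psubset.prems(1) False] by blast
    define W' where "W' = W - {i, j}"
    have W': "W' \<subset> W" "W = W' \<union> {i, j}" "W' \<inter> {i, j} = {}" "finite W'"
      using ij psubset.hyps by (auto simp: W'_def)
    have disc_eq: "disc v W' u = disc v W u" for u
      unfolding W'_def using disc_remove_pair[OF psubset.hyps ij] .
    have cd: "covector_discrepancy v W' = covector_discrepancy v W"
      unfolding covector_discrepancy_eq_Max[OF W'(4)] covector_discrepancy_eq_Max[OF psubset.hyps] disc_eq ..
    obtain m Vs where m: "m \<ge> dim (v ` W') - covector_discrepancy v W" "codeg_star_decomposition v W' Vs m"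
      using psubset.IH[OF W'(1)] psubset.prems W'(1) unfolding cd by blast
    have "covector_discrepancy v {i, j} \<le> 0"
      by (rule covector_discrepancy_le) (use disc_pair[OF ij(3-5)] in auto)
    moreover have "2 * codeg_star v {i, j} + covector_discrepancy v {i, j} = card {i, j}"
      by (rule codeg_star_formula) (use psubset.prems(1) ij in auto)
    ultimately have cp: "codeg_star v {i, j} = 1" using ij(3) by simp
    have "2 * codeg_star v W' + covector_discrepancy v W' = card W'"
      by (rule codeg_star_formula) (use psubset.prems(1) W' in auto)
    moreover have "2 * codeg_star v W + covector_discrepancy v W = card W"
      by (rule codeg_star_formula) (use psubset.prems(1) psubset.hyps in auto)
    moreover have "card W = card W' + 2" using W' ij(3) card_Un_disjoint[of W' "{i, j}"] by simp
    ultimately have "codeg_star v W = codeg_star v W' + codeg_star v {i, j}" using cd cp by linarith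
    then have dec: "codeg_star_decomposition v W (Vs(Suc m := {i, j})) (Suc m)"
      using decomposition_add_pair[OF m(2) W'(3)] W'(2) cp by simp
    have "v ` W \<subseteq> span (insert (v i) (v ` W'))"
    proof clarify
      fix k assume "k \<in> W"
      then consider "k \<in> W'" | "k = i" | "k = j" using W'(2) by auto
      then show "v k \<in> span (insert (v i) (v ` W'))"
        by cases (auto simp: ij(5) intro: span_base span_neg span_scale)
    qed
    then have "dim (v ` W) \<le> dim (insert (v i) (v ` W'))" by (metis dim_span dim_subset)
    also have "\<dots> \<le> dim (v ` W') + 1" by (simp add: dim_insert)
    finally have "Suc m \<ge> dim (v ` W) - covector_discrepancy v W" using m(1) by linarith
    then show ?thesis using dec by blast
  qed
qed

theorem mainTheorem2:
  fixes I :: "'i set" and v :: "'i \<Rightarrow> 'a::euclidean_space"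
  assumes "finite I"
    and "\<forall>i\<in>I. v i \<noteq> 0"
    and "covector_discrepancy v I \<le> 2"
  shows "\<exists>m Vs. m \<ge> rank_conf v I - covector_discrepancy v I
                 \<and> codeg_star_decomposition v I Vs m"
  using decomposition_exists[OF assms(1) _ assms(3)] assms(2) by (simp add: rank_conf_def)

end
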